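(* Let $f:[0,\infty)\to\mathbb R$ be $C^3$, $\beta\in\mathbb R$, $\ell>0$, and let $\phi:[0,\ell]\to\mathbb R$ solve $\phi_{xx}+f(\phi^2)\phi+\beta\phi=0$ with Neumann boundary conditions $\phi'(0)=\phi'(\ell)=0$. Suppose that $0\notin\operatorname{Spec}(L_-)\cap\operatorname{Spec}(L_+)$, that $\phi$ is nonconstant, that $\phi(x)\ne0$ for all $x\in[0,\ell]$, and that $\phi$ has one or more critical points in $(0,\ell)$. Then the standing wave $\widehat\psi(x,t)=e^{i\beta t}\phi(x)$ is spectrally unstable.
   Context: $\widehat\psi$ is a standing wave solution of $i\psi_t=\psi_{xx}+f(|\psi|^2)\psi$ on $[0,\ell]$. Put $g(x)=2f'(\phi^2(x))\phi^2(x)+f(\phi^2(x))+\beta$, $h(x)=f(\phi^2(x))+\beta$, $L_+=-\partial_{xx}-g(x)$, $L_-=-\partial_{xx}-h(x)$, both unbounded operators in $L^2(0,\ell)$ with (Dirichlet) domain $H^2(0,\ell)\cap H^1_0(0,\ell)$, and $N=\begin{pmatrix}0&-L_-\\L_+&0\end{pmatrix}$ with domain $(H^2(0,\ell)\cap H^1_0(0,\ell))^2\subset L^2(0,\ell)^2$. Spectrally unstable means that $N$ has spectrum in the open right half plane. *)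

theory Defs
  imports "HOL-Analysis.Analysis"
begin

definition deriv_on :: "real set \<Rightarrow> (real \<Rightarrow> real) \<Rightarrow> real \<Rightarrow> real" where
  "deriv_on S f x = vector_derivative f (at x within S)"

text \<open>Class \<open>C^k\<close> on \<open>S\<close>, with one-sided derivatives at the end points of an interval.\<close>

primrec C_k_on :: "nat \<Rightarrow> (real \<Rightarrow> real) \<Rightarrow> real set \<Rightarrow> bool" where
  "C_k_on 0 f S \<longleftrightarrow> continuous_on S f"
| "C_k_on (Suc k) f S \<longleftrightarrow>
     (\<forall>x\<in>S. f differentiable (at x within S)) \<and> C_k_on k (deriv_on S f) S"


section \<open>Square integrable functions and Sobolev spaces on \<open>(0,l)\<close>\<close>

text \<open>
  Elements of \<open>L\<^sup>2(0,l)\<close> are given by representatives, total functions on the reals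
  whose values outside \<open>(0,l)\<close> are irrelevant. The vector space \<open>L\<^sup>2(0,l)\<^sup>2\<close> is
  the case of values in \<^typ>\<open>complex \<times> complex\<close>, whose norm is the Euclidean one.
\<close>

abbreviation meas :: "real \<Rightarrow> real measure" where
  "meas l \<equiv> lebesgue_on {0<..<l}"

definition L2 :: "real \<Rightarrow> (real \<Rightarrow> 'a::real_normed_vector) set" where
  "L2 l = {u \<in> borel_measurable (meas l). integrable (meas l) (\<lambda>x. (norm (u x))\<^sup>2)}"

definition L2_norm :: "real \<Rightarrow> (real \<Rightarrow> 'a::real_normed_vector) \<Rightarrow> real" where
  "L2_norm l u = sqrt (\<integral>x. (norm (u x))\<^sup>2 \<partial>(meas l))"

text \<open>The space \<open>C\<^sup>1\<close> with compact support in \<open>(0,l)\<close>, extended by zero to the real line.\<close>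

definition test_functions :: "real \<Rightarrow> (real \<Rightarrow> complex) set" where
  "test_functions l =
     {\<eta>. \<eta> C1_differentiable_on UNIV \<and> closure {x. \<eta> x \<noteq> 0} \<subseteq> {0<..<l}}"

definition weak_deriv :: "real \<Rightarrow> (real \<Rightarrow> complex) \<Rightarrow> (real \<Rightarrow> complex) \<Rightarrow> bool" where
  "weak_deriv l u v \<longleftrightarrow>
     (\<forall>\<eta>\<in>test_functions l.
        (\<integral>x. u x * vector_derivative \<eta> (at x) \<partial>(meas l)) = - (\<integral>x. v x * \<eta> x \<partial>(meas l)))"

definition H1 :: "real \<Rightarrow> (real \<Rightarrow> complex) set" where
  "H1 l = {u \<in> L2 l. \<exists>v\<in>L2 l. weak_deriv l u v}"

definition H2 :: "real \<Rightarrow> (real \<Rightarrow> complex) set" where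
  "H2 l = {u \<in> H1 l. \<exists>v\<in>H1 l. weak_deriv l u v}"

text \<open>The closure of the test functions with respect to the norm of \<open>H\<^sup>1(0,l)\<close>.\<close>

definition H1_0 :: "real \<Rightarrow> (real \<Rightarrow> complex) set" where
  "H1_0 l = {u \<in> H1 l. \<exists>v\<in>L2 l. weak_deriv l u v \<and>
     (\<forall>\<epsilon>>0. \<exists>\<eta>\<in>test_functions l.
        sqrt ((L2_norm l (\<lambda>x. u x - \<eta> x))\<^sup>2
            + (L2_norm l (\<lambda>x. v x - vector_derivative \<eta> (at x)))\<^sup>2) < \<epsilon>)}"


section \<open>Spectrum of an unbounded operator\<close>

text \<open>
  An unbounded operator in \<open>L\<^sup>2\<close> is given by its graph on the level of representatives:
  a set of pairs that is closed under modification of either component on a null set.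
  Equality in \<open>L\<^sup>2\<close> is equality almost everywhere.
\<close>

definition boundedly_invertible ::
  "real \<Rightarrow> ((real \<Rightarrow> 'a::real_normed_vector) \<times> (real \<Rightarrow> 'a)) set \<Rightarrow> bool" where
  "boundedly_invertible l T \<longleftrightarrow>
     (\<forall>w\<in>L2 l. \<exists>u. (u, w) \<in> T) \<and>
     (\<forall>u u' w. (u, w) \<in> T \<longrightarrow> (u', w) \<in> T \<longrightarrow> (AE x in meas l. u x = u' x)) \<and>
     (\<exists>C. \<forall>(u, w)\<in>T. L2_norm l u \<le> C * L2_norm l w)"

text \<open>
  The parameter \<open>sc\<close> is the multiplication of values by complex scalars; it is needed
  because \<^typ>\<open>complex \<times> complex\<close> carries only a real scalar multiplication.
\<close>

definition spectrum ::
  "real \<Rightarrow> (complex \<Rightarrow> 'a \<Rightarrow> 'a) \<Rightarrow>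
   ((real \<Rightarrow> 'a::real_normed_vector) \<times> (real \<Rightarrow> 'a)) set \<Rightarrow> complex set" where
  "spectrum l sc A =
     {z. \<not> boundedly_invertible l {(u, \<lambda>x. v x - sc z (u x)) | u v. (u, v) \<in> A}}"

definition pair_scale :: "complex \<Rightarrow> complex \<times> complex \<Rightarrow> complex \<times> complex" where
  "pair_scale z p = (z * fst p, z * snd p)"


section \<open>The linearization about a standing wave\<close>

text \<open>The operator \<open>- \<partial>\<^sub>x\<^sub>x - q\<close> with domain \<open>H\<^sup>2(0,l) \<inter> H\<^sup>1\<^sub>0(0,l)\<close>.\<close>

definition dirichlet_op ::
  "real \<Rightarrow> (real \<Rightarrow> real) \<Rightarrow> ((real \<Rightarrow> complex) \<times> (real \<Rightarrow> complex)) set" where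
  "dirichlet_op l q =
     {(u, v). u \<in> H2 l \<inter> H1_0 l \<and> v \<in> L2 l \<and>
        (\<exists>u1\<in>L2 l. \<exists>u2\<in>L2 l. weak_deriv l u u1 \<and> weak_deriv l u1 u2 \<and>
           (AE x in meas l. v x = - u2 x - of_real (q x) * u x))}"

definition g_pot :: "(real \<Rightarrow> real) \<Rightarrow> real \<Rightarrow> (real \<Rightarrow> real) \<Rightarrow> real \<Rightarrow> real" where
  "g_pot f \<beta> \<phi> x =
     2 * deriv_on {0..} f ((\<phi> x)\<^sup>2) * (\<phi> x)\<^sup>2 + f ((\<phi> x)\<^sup>2) + \<beta>"

definition h_pot :: "(real \<Rightarrow> real) \<Rightarrow> real \<Rightarrow> (real \<Rightarrow> real) \<Rightarrow> real \<Rightarrow> real" where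
  "h_pot f \<beta> \<phi> x = f ((\<phi> x)\<^sup>2) + \<beta>"

definition L_plus where
  "L_plus f \<beta> l \<phi> = dirichlet_op l (g_pot f \<beta> \<phi>)"

definition L_minus where
  "L_minus f \<beta> l \<phi> = dirichlet_op l (h_pot f \<beta> \<phi>)"

text \<open>The operator \<open>N (u, w) = (- L\<^sub>- w, L\<^sub>+ u)\<close>.\<close>

definition N_op ::
  "(real \<Rightarrow> real) \<Rightarrow> real \<Rightarrow> real \<Rightarrow> (real \<Rightarrow> real) \<Rightarrow>
   ((real \<Rightarrow> complex \<times> complex) \<times> (real \<Rightarrow> complex \<times> complex)) set" where
  "N_op f \<beta> l \<phi> =
     {(\<lambda>x. (u x, w x), \<lambda>x. (- a x, b x)) | u w a b.
        (w, a) \<in> L_minus f \<beta> l \<phi> \<and> (u, b) \<in> L_plus f \<beta> l \<phi>}"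

text \<open>
  The profile equation says that \<open>\<psi>(x,t) = exp (i \<beta> t) \<phi>(x)\<close> solves
  \<open>i \<psi>\<^sub>t = \<psi>\<^sub>x\<^sub>x + f(|\<psi>|\<^sup>2) \<psi>\<close> on \<open>[0,l]\<close>.
\<close>

definition neumann_profile ::
  "(real \<Rightarrow> real) \<Rightarrow> real \<Rightarrow> real \<Rightarrow> (real \<Rightarrow> real) \<Rightarrow> bool" where
  "neumann_profile f \<beta> l \<phi> \<longleftrightarrow>
     C_k_on 2 \<phi> {0..l} \<and>
     (\<forall>x\<in>{0..l}. deriv_on {0..l} (deriv_on {0..l} \<phi>) x + f ((\<phi> x)\<^sup>2) * \<phi> x + \<beta> * \<phi> x = 0) \<and>
     deriv_on {0..l} \<phi> 0 = 0 \<and> deriv_on {0..l} \<phi> l = 0"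

text \<open>Spectral instability of the standing wave \<open>exp (i \<beta> t) \<phi>(x)\<close>.\<close>

definition spectrally_unstable ::
  "(real \<Rightarrow> real) \<Rightarrow> real \<Rightarrow> real \<Rightarrow> (real \<Rightarrow> real) \<Rightarrow> bool" where
  "spectrally_unstable f \<beta> l \<phi> \<longleftrightarrow>
     (\<exists>z\<in>spectrum l pair_scale (N_op f \<beta> l \<phi>). Re z > 0)"

end

theory Submission
  imports Defs
begin

text \<open>
  The proof is variational. Let $L_+$ and $L_-$ be the two Dirichlet operators.

  The profile $\phi$ solves $\phi'' + h \phi = 0$ and has no zeros, so that the form of $L_-$ is
  nonnegative by Jacobi's factorization, \<open>dirichlet_op_nonneg\<close>. Differentiating the profile
  equation gives $\phi''' + g \phi' = 0$, and the Neumann condition for $\phi$ is the Dirichlet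
  condition for $\phi'$. Hence $\phi'$ is in the kernel of $L_+$, and the hypothesis on the spectra
  says that $L_-$ is boundedly invertible. As $\phi'$ changes sign at the interior critical point
  (its zeros are simple), $0$ is not the bottom of the spectrum of $L_+$: there is a $u$ in the domain
  with $\langle L_+ u, u\rangle < 0$, \<open>dirichlet_negative_direction\<close>.

  A real number $\lambda > 0$ is an eigenvalue of $N$ with first component $u$ exactly if
  $L_+ u + \lambda^2 L_-^{-1} u = 0$. So the candidate is $\lambda^2 = \mu$, where $\mu$ is the smallest
  number for which the form of $L_+ + \mu L_-^{-1}$ is nonnegative; it is positive because of the
  negative direction. Showing that $\lambda$ is in the spectrum does not require an eigenvector: if
  $N - \lambda$ were boundedly invertible, then so would be $L_+ + \mu L_-^{-1}$, its form would be
  coercive, and $\mu$ would not be minimal. This is \<open>positive_spectrum_of_block_operator\<close>.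

  All of this uses little about Sobolev spaces: integration by parts in the operator domain,
  \<open>dirichlet_form\<close>, and the fact that classical functions with zero boundary values belong to the
  domain, \<open>dirichlet_classical\<close>.
\<close>

section \<open>Square integrable functions on an interval\<close>

lemma meas_finite: "finite_measure (meas l)"
  by (rule finite_measure_lebesgue_on) simp

lemma continuous_on_measurable_meas:
  fixes f :: "real \<Rightarrow> 'a::euclidean_space"
  assumes "continuous_on {0..l} f"
  shows "f \<in> borel_measurable (meas l)"
  by (rule continuous_imp_measurable_on_sets_lebesgue)
     (auto intro: continuous_on_subset[OF assms])

lemma continuous_on_interval_bound:
  fixes f :: "real \<Rightarrow> 'a::real_normed_vector"
  assumes "continuous_on {a..b} f"
  obtains B where "B > 0" "\<And>x. x \<in> {a..b} \<Longrightarrow> norm (f x) \<le> B"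
proof -
  have "bounded (f ` {a..b})"
    using compact_continuous_image[OF assms] compact_imp_bounded by simp
  then show ?thesis using that unfolding bounded_pos by auto
qed

lemma bounded_integrable_meas:
  fixes f :: "real \<Rightarrow> 'a::euclidean_space"
  assumes "f \<in> borel_measurable (meas l)" "\<And>x. x \<in> {0<..<l} \<Longrightarrow> norm (f x) \<le> B"
  shows "integrable (meas l) f"
proof -
  interpret finite_measure "meas l" by (rule meas_finite)
  show ?thesis
    by (rule integrable_const_bound[of _ B]) (use assms in \<open>auto intro!: AE_I2\<close>)
qed

lemma continuous_on_integrable_meas:
  fixes f :: "real \<Rightarrow> 'a::euclidean_space"
  assumes "continuous_on {0..l} f"
  shows "integrable (meas l) f"
proof -
  obtain B where "\<And>x. x \<in> {0..l} \<Longrightarrow> norm (f x) \<le> B"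
    using continuous_on_interval_bound[OF assms] by blast
  then show ?thesis
    by (intro bounded_integrable_meas[of _ _ B] continuous_on_measurable_meas assms) auto
qed

lemma integral_meas_FTC:
  fixes F :: "real \<Rightarrow> 'a::euclidean_space"
  assumes "l \<ge> 0" "\<And>x. x \<in> {0..l} \<Longrightarrow> (F has_vector_derivative f x) (at x within {0..l})"
    and "continuous_on {0..l} f"
  shows "(\<integral>x. f x \<partial>(meas l)) = F l - F 0"
proof -
  have "(f has_integral (\<integral>x. f x \<partial>(meas l))) {0<..<l}"
    by (rule has_integral_integral_lebesgue_on)
       (auto intro: continuous_on_integrable_meas assms)
  then have "(f has_integral (\<integral>x. f x \<partial>(meas l))) {0..l}"
    by (simp add: has_integral_Icc_iff_Ioo)
  moreover have "(f has_integral F l - F 0) {0..l}"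
    using fundamental_theorem_of_calculus assms by blast
  ultimately show ?thesis using has_integral_unique by blast
qed

lemma L2_D: "u \<in> L2 l \<Longrightarrow> u \<in> borel_measurable (meas l)"
  "u \<in> L2 l \<Longrightarrow> integrable (meas l) (\<lambda>x. (norm (u x))\<^sup>2)"
  by (auto simp: L2_def)

lemma bounded_in_L2:
  fixes u :: "real \<Rightarrow> 'a::euclidean_space"
  assumes "u \<in> borel_measurable (meas l)" "\<And>x. x \<in> {0<..<l} \<Longrightarrow> norm (u x) \<le> B"
  shows "u \<in> L2 l"
  unfolding L2_def using assms
  by (auto intro!: bounded_integrable_meas[of _ _ "B\<^sup>2"] power_mono)

lemma continuous_in_L2:
  fixes u :: "real \<Rightarrow> 'a::euclidean_space"
  assumes "continuous_on {0..l} u"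
  shows "u \<in> L2 l"
proof -
  obtain B where "\<And>x. x \<in> {0..l} \<Longrightarrow> norm (u x) \<le> B"
    using continuous_on_interval_bound[OF assms] by blast
  then show ?thesis
    by (intro bounded_in_L2[of _ _ B] continuous_on_measurable_meas assms) auto
qed

text \<open>
  The real part of the $L^2$ inner product. A real form is enough because every operator,
  shift and multiplier that enters the variational argument is real.
\<close>

definition ip :: "real \<Rightarrow> (real \<Rightarrow> 'a::real_inner) \<Rightarrow> (real \<Rightarrow> 'a) \<Rightarrow> real" where
  "ip l u v = (\<integral>x. u x \<bullet> v x \<partial>(meas l))"

lemma ip_commute: "ip l u v = ip l v u"
  by (simp add: ip_def inner_commute)

lemma L2_ip_integrable:
  fixes u v :: "real \<Rightarrow> 'a::euclidean_space"
  assumes "u \<in> L2 l" "v \<in> L2 l"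
  shows "integrable (meas l) (\<lambda>x. u x \<bullet> v x)"
proof (rule Bochner_Integration.integrable_bound)
  show "integrable (meas l) (\<lambda>x. (norm (u x))\<^sup>2 + (norm (v x))\<^sup>2)"
    using assms by (auto dest: L2_D)
  show "(\<lambda>x. u x \<bullet> v x) \<in> borel_measurable (meas l)"
    using L2_D(1)[OF assms(1)] L2_D(1)[OF assms(2)] by (rule borel_measurable_inner)
  show "AE x in meas l. norm (u x \<bullet> v x) \<le> norm ((norm (u x))\<^sup>2 + (norm (v x))\<^sup>2)"
  proof (rule AE_I2)
    fix x
    have "0 \<le> norm (u x) * norm (v x)" by simp
    then have "norm (u x) * norm (v x) \<le> (norm (u x))\<^sup>2 + (norm (v x))\<^sup>2"
      using sum_squares_bound[of "norm (u x)" "norm (v x)"] by linarith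
    then have "\<bar>u x \<bullet> v x\<bar> \<le> (norm (u x))\<^sup>2 + (norm (v x))\<^sup>2"
      using Cauchy_Schwarz_ineq2[of "u x" "v x"] by linarith
    then show "norm (u x \<bullet> v x) \<le> norm ((norm (u x))\<^sup>2 + (norm (v x))\<^sup>2)"
      unfolding real_norm_def by linarith
  qed
qed

lemma L2_scaleR:
  fixes u :: "real \<Rightarrow> 'a::euclidean_space"
  assumes "u \<in> L2 l"
  shows "(\<lambda>x. c *\<^sub>R u x) \<in> L2 l"
  using assms by (auto simp: L2_def power_mult_distrib)

lemma L2_add:
  fixes u v :: "real \<Rightarrow> 'a::euclidean_space"
  assumes "u \<in> L2 l" "v \<in> L2 l"
  shows "(\<lambda>x. u x + v x) \<in> L2 l"
proof -
  have "(norm (u x + v x))\<^sup>2 = (norm (u x))\<^sup>2 + 2 * (u x \<bullet> v x) + (norm (v x))\<^sup>2" for x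
    by (simp add: power2_norm_eq_inner inner_simps inner_commute)
  then show ?thesis
    using assms L2_ip_integrable[OF assms] by (auto simp: L2_def)
qed

lemma L2_uminus:
  fixes u :: "real \<Rightarrow> 'a::euclidean_space"
  assumes "u \<in> L2 l"
  shows "(\<lambda>x. - u x) \<in> L2 l"
  using L2_scaleR[OF assms, of "-1"] by simp

lemma L2_diff:
  fixes u v :: "real \<Rightarrow> 'a::euclidean_space"
  assumes "u \<in> L2 l" "v \<in> L2 l"
  shows "(\<lambda>x. u x - v x) \<in> L2 l"
  using L2_add[OF assms(1) L2_uminus[OF assms(2)]] by simp

lemma L2_mult_continuous:
  fixes u :: "real \<Rightarrow> complex"
  assumes "u \<in> L2 l" "continuous_on {0..l} q"
  shows "(\<lambda>x. of_real (q x) * u x) \<in> L2 l"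
proof -
  obtain B where B: "B > 0" "\<And>x. x \<in> {0..l} \<Longrightarrow> norm (q x) \<le> B"
    using continuous_on_interval_bound[OF assms(2)] by blast
  have [measurable]: "u \<in> borel_measurable (meas l)" "q \<in> borel_measurable (meas l)"
    using assms L2_D continuous_on_measurable_meas by blast+
  have "integrable (meas l) (\<lambda>x. (norm (of_real (q x) * u x))\<^sup>2)"
  proof (rule Bochner_Integration.integrable_bound)
    show "integrable (meas l) (\<lambda>x. B\<^sup>2 * (norm (u x))\<^sup>2)"
      using assms by (auto dest: L2_D)
    show "AE x in meas l. norm ((norm (of_real (q x) * u x))\<^sup>2) \<le> norm (B\<^sup>2 * (norm (u x))\<^sup>2)"
      using B by (intro AE_I2) (auto simp: norm_mult power_mult_distrib intro!: mult_right_mono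
        power2_le_iff_abs_le[THEN iffD2])
  qed measurable
  then show ?thesis by (simp add: L2_def)
qed

lemma L2_norm_nonneg: "L2_norm l u \<ge> 0"
  by (simp add: L2_norm_def)

lemma L2_norm_sq: 
  fixes u :: "real \<Rightarrow> 'a::real_inner"
  shows "(L2_norm l u)\<^sup>2 = ip l u u"
  by (simp add: L2_norm_def ip_def power2_norm_eq_inner)

lemma ip_nonneg: "ip l u u \<ge> 0"
  by (simp add: ip_def)

lemma ip_linear:
  fixes u v w :: "real \<Rightarrow> 'a::euclidean_space"
  assumes "u \<in> L2 l" "v \<in> L2 l" "w \<in> L2 l"
  shows "ip l (\<lambda>x. u x + v x) w = ip l u w + ip l v w"
    "ip l (\<lambda>x. u x - v x) w = ip l u w - ip l v w"
    "ip l w (\<lambda>x. u x + v x) = ip l w u + ip l w v"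
    "ip l w (\<lambda>x. u x - v x) = ip l w u - ip l w v"
  using assms by (auto simp: ip_def inner_simps L2_ip_integrable)

lemma ip_scaleR [simp]:
  "ip l (\<lambda>x. c *\<^sub>R u x) w = c * ip l u w" "ip l w (\<lambda>x. c *\<^sub>R u x) = c * ip l w u"
  by (auto simp: ip_def)

lemma ip_uminus [simp]:
  "ip l (\<lambda>x. - u x) w = - ip l u w" "ip l w (\<lambda>x. - u x) = - ip l w u"
  by (auto simp: ip_def)

lemma ip_cong_AE:
  fixes u u' v :: "real \<Rightarrow> 'a::euclidean_space"
  assumes "u \<in> L2 l" "u' \<in> L2 l" "v \<in> L2 l" "AE x in meas l. u x = u' x"
  shows "ip l u v = ip l u' v"
  unfolding ip_def
  by (rule integral_cong_AE) (use assms in \<open>auto intro: borel_measurable_inner dest: L2_D\<close>)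

text \<open>
  The Cauchy--Schwarz inequality for a nonnegative form, reduced to one real variable. It is
  applied below to forms that are only semidefinite, and whose arguments are tuples of functions
  rather than vectors of some vector space type.
\<close>

lemma discriminant_nonneg_quadratic:
  fixes a b c :: real
  assumes "\<And>t. a + 2 * t * b + t\<^sup>2 * c \<ge> 0" "c \<ge> 0"
  shows "b\<^sup>2 \<le> a * c"
proof (cases "c = 0")
  case True
  have "b = 0"
  proof (rule ccontr)
    assume "b \<noteq> 0"
    have "a + 2 * (- (a + 1) / (2 * b)) * b = -1" using \<open>b \<noteq> 0\<close> by (simp add: field_simps)
    then show False using assms(1)[of "- (a + 1) / (2 * b)"] True by simp
  qed
  then show ?thesis using True by simp
next
  case False
  then have c: "c > 0" using assms(2) by simp
  have "a + 2 * (- b / c) * b + (- b / c)\<^sup>2 * c = a - b\<^sup>2 / c"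
    using c by (simp add: field_simps power2_eq_square)
  then have "a - b\<^sup>2 / c \<ge> 0" using assms(1)[of "- b / c"] by simp
  then show ?thesis using c by (simp add: field_simps)
qed

lemma ip_Cauchy_Schwarz:
  fixes u v :: "real \<Rightarrow> 'a::euclidean_space"
  assumes "u \<in> L2 l" "v \<in> L2 l"
  shows "\<bar>ip l u v\<bar> \<le> L2_norm l u * L2_norm l v"
proof -
  have "(ip l u v)\<^sup>2 \<le> ip l u u * ip l v v"
  proof (rule discriminant_nonneg_quadratic)
    fix t :: real
    have "0 \<le> ip l (\<lambda>x. u x + t *\<^sub>R v x) (\<lambda>x. u x + t *\<^sub>R v x)" by (rule ip_nonneg)
    also have "\<dots> = ip l u u + 2 * t * ip l u v + t\<^sup>2 * ip l v v"
      using assms by (simp add: ip_linear L2_add L2_scaleR ip_commute[of l v u] power2_eq_square algebra_simps)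
    finally show "0 \<le> ip l u u + 2 * t * ip l u v + t\<^sup>2 * ip l v v" .
  qed (rule ip_nonneg)
  also have "\<dots> = (L2_norm l u * L2_norm l v)\<^sup>2" by (simp add: L2_norm_sq power_mult_distrib)
  finally show ?thesis
    by (simp add: abs_le_square_iff[symmetric] abs_mult L2_norm_nonneg)
qed

lemma ip_tendsto:
  fixes u v :: "real \<Rightarrow> 'a::euclidean_space"
  assumes L: "u \<in> L2 l" "v \<in> L2 l" "\<And>n. U n \<in> L2 l" "\<And>n. V n \<in> L2 l"
    and lim: "(\<lambda>n::nat. L2_norm l (\<lambda>x. u x - U n x)) \<longlonglongrightarrow> 0" "(\<lambda>n. L2_norm l (\<lambda>x. v x - V n x)) \<longlonglongrightarrow> 0"
  shows "(\<lambda>n. ip l (U n) (V n)) \<longlonglongrightarrow> ip l u v"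
proof -
  have "(\<lambda>n. ip l u v - ip l (U n) (V n)) \<longlonglongrightarrow> 0"
  proof (rule Lim_null_comparison)
    let ?a = "\<lambda>n. L2_norm l (\<lambda>x. u x - U n x)" and ?b = "\<lambda>n. L2_norm l (\<lambda>x. v x - V n x)"
    show "(\<lambda>n. ?a n * L2_norm l v + L2_norm l u * ?b n + ?a n * ?b n) \<longlonglongrightarrow> 0"
      using lim by (auto intro!: tendsto_eq_intros)
    show "\<forall>\<^sub>F n in sequentially. norm (ip l u v - ip l (U n) (V n)) \<le>
        ?a n * L2_norm l v + L2_norm l u * ?b n + ?a n * ?b n"
    proof (rule always_eventually, rule allI)
      fix n
      have D: "(\<lambda>x. u x - U n x) \<in> L2 l" "(\<lambda>x. v x - V n x) \<in> L2 l"
        using L by (auto intro: L2_diff)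
      have "ip l u v - ip l (U n) (V n) = ip l (\<lambda>x. u x - U n x) v + ip l u (\<lambda>x. v x - V n x)
          - ip l (\<lambda>x. u x - U n x) (\<lambda>x. v x - V n x)"
        using L D by (simp add: ip_linear)
      then show "norm (ip l u v - ip l (U n) (V n)) \<le>
          ?a n * L2_norm l v + L2_norm l u * ?b n + ?a n * ?b n"
        using ip_Cauchy_Schwarz[OF D(1) L(2)] ip_Cauchy_Schwarz[OF L(1) D(2)]
          ip_Cauchy_Schwarz[OF D] by simp
    qed
  qed
  then have "(\<lambda>n. ip l u v - (ip l u v - ip l (U n) (V n))) \<longlonglongrightarrow> ip l u v - 0"
    by (intro tendsto_intros)
  then show ?thesis by simp
qed

section \<open>Weak derivatives\<close>

text \<open>
  The support of a test function is enlarged to an interval with end points inside \<open>(0,l)\<close>, so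
  that the function and its derivative vanish outside it; two extra points make the interval
  nondegenerate even for the zero function.
\<close>

lemma test_functionE:
  assumes "\<eta> \<in> test_functions l" "l > 0"
  obtains \<eta>' c d where "0 < c" "c < d" "d < l" "\<And>x. (\<eta> has_vector_derivative \<eta>' x) (at x)"
    "continuous_on UNIV \<eta>'" "\<And>x. vector_derivative \<eta> (at x) = \<eta>' x"
    "\<And>x. x \<notin> {c..d} \<Longrightarrow> \<eta> x = 0" "\<And>x. x \<notin> {c..d} \<Longrightarrow> \<eta>' x = 0"
proof -
  obtain \<eta>' where d1: "\<And>x. (\<eta> has_vector_derivative \<eta>' x) (at x)" and c1: "continuous_on UNIV \<eta>'"
    using assms unfolding test_functions_def C1_differentiable_on_def by auto
  have vd: "vector_derivative \<eta> (at x) = \<eta>' x" for x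
    using d1 vector_derivative_at by blast
  define K where "K = insert (l/3) (insert (l/2) (closure {x. \<eta> x \<noteq> 0}))"
  have sub: "closure {x. \<eta> x \<noteq> 0} \<subseteq> {0<..<l}" using assms by (simp add: test_functions_def)
  then have K: "K \<subseteq> {0<..<l}" using assms by (auto simp: K_def)
  have "compact K"
  proof -
    have "bounded (closure {x. \<eta> x \<noteq> 0})"
      using bounded_subset[OF _ sub] by auto
    then have "compact (closure {x. \<eta> x \<noteq> 0})" by (simp add: compact_eq_bounded_closed)
    then show ?thesis by (simp add: K_def compact_insert)
  qed
  moreover have "K \<noteq> {}" by (simp add: K_def)
  ultimately obtain c d where cd: "c \<in> K" "d \<in> K" "\<And>x. x \<in> K \<Longrightarrow> c \<le> x" "\<And>x. x \<in> K \<Longrightarrow> x \<le> d"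
    by (metis compact_attains_inf compact_attains_sup)
  have z: "\<eta> x = 0" if "x \<notin> {c..d}" for x
  proof (rule ccontr)
    assume "\<eta> x \<noteq> 0"
    then have "x \<in> closure {x. \<eta> x \<noteq> 0}" by (intro subsetD[OF closure_subset]) simp
    then have "x \<in> K" by (simp add: K_def)
    then show False using that cd by auto
  qed
  have "\<eta>' x = 0" if "x \<notin> {c..d}" for x
  proof -
    have "((\<lambda>_. 0) has_vector_derivative 0) (at x)" by simp
    then have "(\<eta> has_vector_derivative 0) (at x)"
      by (rule has_vector_derivative_transform_within_open[of _ _ _ "- {c..d}"])
         (use that z in \<open>auto intro: open_Compl\<close>)
    then show ?thesis using d1 vector_derivative_unique_at by blast
  qed
  moreover have "c < d"
    using cd(3)[of "l/3"] cd(4)[of "l/2"] assms(2) by (simp add: K_def)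
  ultimately show ?thesis
    using that[of c d \<eta>', OF _ _ _ d1 c1 vd z] cd(1,2) K by (meson greaterThanLessThan_iff subsetD)
qed

lemma test_functionI:
  assumes "\<And>x. (\<eta> has_vector_derivative \<eta>' x) (at x)" "continuous_on UNIV \<eta>'"
    and "0 < c" "d < l" "\<And>x. x \<notin> {c..d} \<Longrightarrow> \<eta> x = 0"
  shows "\<eta> \<in> test_functions l"
proof -
  have "closure {x. \<eta> x \<noteq> 0} \<subseteq> {c..d}"
    using assms(5) by (intro closure_minimal subsetI) (blast, simp)
  then have "closure {x. \<eta> x \<noteq> 0} \<subseteq> {0<..<l}" using assms(3,4) by force
  then show ?thesis
    using assms(1,2) unfolding test_functions_def C1_differentiable_on_def by auto
qed

lemma test_function_L2:
  assumes "\<eta> \<in> test_functions l" "l > 0"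
  shows "\<eta> \<in> L2 l" "(\<lambda>x. vector_derivative \<eta> (at x)) \<in> L2 l"
proof -
  obtain \<eta>' where d: "\<And>x. (\<eta> has_vector_derivative \<eta>' x) (at x)"
    "continuous_on UNIV \<eta>'" "\<And>x. vector_derivative \<eta> (at x) = \<eta>' x"
    using test_functionE[OF assms] by metis
  have "continuous_on {0..l} \<eta>"
    using d(1) by (meson continuous_at_imp_continuous_on has_vector_derivative_continuous)
  then show "\<eta> \<in> L2 l" by (rule continuous_in_L2)
  show "(\<lambda>x. vector_derivative \<eta> (at x)) \<in> L2 l"
    unfolding d(3) using d(2) continuous_in_L2 continuous_on_subset by blast
qed

lemma test_function_cnj:
  assumes "\<eta> \<in> test_functions l" "l > 0"
  shows "(\<lambda>x. cnj (\<eta> x)) \<in> test_functions l"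
    "vector_derivative (\<lambda>x. cnj (\<eta> x)) (at x) = cnj (vector_derivative \<eta> (at x))"
proof -
  obtain \<eta>' c d where d: "0 < c" "d < l" "\<And>x. (\<eta> has_vector_derivative \<eta>' x) (at x)"
    "continuous_on UNIV \<eta>'" "\<And>x. vector_derivative \<eta> (at x) = \<eta>' x" "\<And>x. x \<notin> {c..d} \<Longrightarrow> \<eta> x = 0"
    using test_functionE[OF assms] by metis
  have der: "((\<lambda>x. cnj (\<eta> x)) has_vector_derivative cnj (\<eta>' x)) (at x)" for x
    using d(3) by (rule has_vector_derivative_cnj)
  then show "vector_derivative (\<lambda>x. cnj (\<eta> x)) (at x) = cnj (vector_derivative \<eta> (at x))"
    using d(5) vector_derivative_at by metis
  show "(\<lambda>x. cnj (\<eta> x)) \<in> test_functions l"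
    by (rule test_functionI[OF der _ d(1,2)]) (use d in \<open>auto intro: continuous_intros\<close>)
qed

lemma L2_cnj:
  assumes "u \<in> L2 l"
  shows "(\<lambda>x. cnj (u x)) \<in> L2 l"
proof -
  have "(\<lambda>x. cnj (u x)) \<in> borel_measurable (meas l)"
    by (rule measurable_compose[OF L2_D(1)[OF assms]])
       (intro borel_measurable_continuous_onI continuous_intros)
  then show ?thesis using assms by (simp add: L2_def)
qed

lemma L2_mult_integrable:
  fixes u v :: "real \<Rightarrow> complex"
  assumes "u \<in> L2 l" "v \<in> L2 l"
  shows "integrable (meas l) (\<lambda>x. u x * v x)"
proof -
  have cv: "(\<lambda>x. cnj (v x)) \<in> L2 l" by (rule L2_cnj[OF assms(2)])
  have iv: "(\<lambda>x. \<i> * cnj (v x)) \<in> L2 l" using cv by (auto simp: L2_def norm_mult)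
  have "u x * v x = complex_of_real (u x \<bullet> cnj (v x)) + \<i> * complex_of_real (u x \<bullet> (\<i> * cnj (v x)))" for x
    by (simp add: complex_eq_iff inner_complex_def)
  then show ?thesis
    using L2_ip_integrable[OF assms(1) cv] L2_ip_integrable[OF assms(1) iv]
    by (simp add: integrable_of_real)
qed

lemma integral_mult_cnj:
  assumes "u \<in> L2 l" "v \<in> L2 l"
  shows "Re (\<integral>x. u x * cnj (v x) \<partial>(meas l)) = ip l u v"
proof -
  have "(\<lambda>x. cnj (v x)) \<in> L2 l" by (rule L2_cnj[OF assms(2)])
  from L2_mult_integrable[OF assms(1) this] show ?thesis
    by (simp add: ip_def inner_complex_def flip: integral_Re)
qed

text \<open>
  Weak derivatives are defined by the bilinear pairing; testing against the complex conjugate of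
  \<open>\<eta>\<close> turns it into the inner product.
\<close>

lemma weak_deriv_ip:
  assumes "weak_deriv l u v" "u \<in> L2 l" "v \<in> L2 l" "\<eta> \<in> test_functions l" "l > 0"
  shows "ip l u (\<lambda>x. vector_derivative \<eta> (at x)) = - ip l v \<eta>"
proof -
  have "(\<integral>x. u x * cnj (vector_derivative \<eta> (at x)) \<partial>(meas l)) = - (\<integral>x. v x * cnj (\<eta> x) \<partial>(meas l))"
    using assms(1) test_function_cnj[OF assms(4,5)] unfolding weak_deriv_def by auto
  then show ?thesis
    using integral_mult_cnj[OF assms(2) test_function_L2(2)[OF assms(4,5)]]
      integral_mult_cnj[OF assms(3) test_function_L2(1)[OF assms(4,5)]]
    by simp
qed

lemma weak_deriv_classical:
  assumes "l > 0" "\<And>x. x \<in> {0..l} \<Longrightarrow> (u has_vector_derivative u' x) (at x within {0..l})"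
    and "continuous_on {0..l} u'"
  shows "weak_deriv l u u'"
  unfolding weak_deriv_def
proof
  fix \<eta> assume \<eta>: "\<eta> \<in> test_functions l"
  obtain \<eta>' c d where d: "0 < c" "d < l" "\<And>x. (\<eta> has_vector_derivative \<eta>' x) (at x)"
    "continuous_on UNIV \<eta>'" "\<And>x. vector_derivative \<eta> (at x) = \<eta>' x" "\<And>x. x \<notin> {c..d} \<Longrightarrow> \<eta> x = 0"
    using test_functionE[OF \<eta> assms(1)] by metis
  have cu: "continuous_on {0..l} u"
    using assms(2) by (meson continuous_on_eq_continuous_within has_vector_derivative_continuous)
  have c\<eta>: "continuous_on {0..l} \<eta>"
    using d(3) by (meson continuous_at_imp_continuous_on has_vector_derivative_continuous)
  have c\<eta>': "continuous_on {0..l} \<eta>'" using d(4) continuous_on_subset by blast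
  have der: "((\<lambda>x. u x * \<eta> x) has_vector_derivative u x * \<eta>' x + u' x * \<eta> x) (at x within {0..l})"
    if "x \<in> {0..l}" for x
    by (rule has_vector_derivative_mult[OF assms(2)[OF that] has_vector_derivative_at_within[OF d(3)]])
  have "(\<integral>x. u x * \<eta>' x + u' x * \<eta> x \<partial>(meas l)) = u l * \<eta> l - u 0 * \<eta> 0"
    by (rule integral_meas_FTC[OF _ der]) (use assms cu c\<eta> c\<eta>' in \<open>auto intro!: continuous_intros\<close>)
  also have "\<dots> = 0" using d by auto
  finally have "(\<integral>x. u x * \<eta>' x \<partial>(meas l)) + (\<integral>x. u' x * \<eta> x \<partial>(meas l)) = 0"
    by (subst (asm) Bochner_Integration.integral_add)
       (use assms cu c\<eta> c\<eta>' in \<open>auto intro!: continuous_on_integrable_meas continuous_intros\<close>)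
  then show "(\<integral>x. u x * vector_derivative \<eta> (at x) \<partial>(meas l)) = - (\<integral>x. u' x * \<eta> x \<partial>(meas l))"
    by (simp add: d(5) eq_neg_iff_add_eq_0)
qed

text \<open>
  Uniqueness of weak derivatives in the form in which it is used: the difference \<open>v\<close> of two weak
  derivatives annihilates all test functions. The difference quotients of \<open>\<eta>\<close> are test functions,
  they are bounded by the supremum of \<open>|\<eta>'|\<close> and converge to \<open>\<eta>'\<close>; hence \<open>v\<close> annihilates \<open>\<eta>'\<close>
  as well, although \<open>\<eta>'\<close> is merely continuous.
\<close>

lemma weak_deriv_ip_unique:
  assumes "weak_deriv l u v1" "weak_deriv l u v2" "u \<in> L2 l" "v1 \<in> L2 l" "v2 \<in> L2 l"
    and \<eta>: "\<eta> \<in> test_functions l" and l: "l > 0"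
  shows "ip l v1 (\<lambda>x. vector_derivative \<eta> (at x)) = ip l v2 (\<lambda>x. vector_derivative \<eta> (at x))"
proof -
  define v where "v = (\<lambda>x. v1 x - v2 x)"
  have v: "v \<in> L2 l" unfolding v_def using assms by (intro L2_diff)
  have orth: "ip l v \<zeta> = 0" if "\<zeta> \<in> test_functions l" for \<zeta>
    using weak_deriv_ip[OF assms(1,3,4) that l] weak_deriv_ip[OF assms(2,3,5) that l]
      test_function_L2(1)[OF that l] assms unfolding v_def by (simp add: ip_linear)
  obtain \<eta>' c d where d: "0 < c" "d < l" "\<And>x. (\<eta> has_vector_derivative \<eta>' x) (at x)"
    "continuous_on UNIV \<eta>'" "\<And>x. vector_derivative \<eta> (at x) = \<eta>' x" "\<And>x. x \<notin> {c..d} \<Longrightarrow> \<eta> x = 0"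
    "\<And>x. x \<notin> {c..d} \<Longrightarrow> \<eta>' x = 0" "c < d"
    using test_functionE[OF \<eta> l] by metis
  have c\<eta>: "continuous_on S \<eta>" for S
    using d(3) by (meson continuous_at_imp_continuous_on has_vector_derivative_continuous)
  obtain B where B: "B > 0" "\<And>x. x \<in> {c..d} \<Longrightarrow> norm (\<eta>' x) \<le> B"
    using continuous_on_interval_bound[of c d \<eta>'] d(4) continuous_on_subset by blast
  have B': "norm (\<eta>' x) \<le> B" for x
    using B d(7) by (cases "x \<in> {c..d}") auto
  define h where "h n = (c / 2) / real (Suc n)" for n
  \<comment> \<open>A shift by at most half the distance of the support to 0 keeps the support inside the interval.\<close>
  have h: "h n > 0" "h n \<le> c / 2" for n
    using d(1) by (auto simp: h_def field_simps)
  have h0: "h \<longlonglongrightarrow> 0"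
    unfolding h_def using LIMSEQ_Suc[OF lim_const_over_n[of "c/2"]] by simp
  define \<psi> where "\<psi> n x = (1 / h n) *\<^sub>R (\<eta> (x + h n) - \<eta> x)" for n x
  have \<psi>: "\<psi> n \<in> test_functions l" for n
  proof (rule test_functionI)
    show "(\<psi> n has_vector_derivative (1 / h n) *\<^sub>R (\<eta>' (x + h n) - \<eta>' x)) (at x)" for x
    proof -
      have "((\<lambda>x. x + h n) has_vector_derivative 1) (at x)"
        using has_vector_derivative_add[OF has_vector_derivative_id has_vector_derivative_const] by simp
      from vector_diff_chain_at[OF this, of \<eta> "\<eta>' (x + h n)"] d(3)
      have "((\<lambda>x. \<eta> (x + h n)) has_vector_derivative \<eta>' (x + h n)) (at x)" by (simp add: o_def)
      from has_vector_derivative_diff[OF this d(3)[of x]]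
      show ?thesis unfolding \<psi>_def
        by (rule bounded_linear.has_vector_derivative[OF bounded_linear_scaleR_right])
    qed
    show "continuous_on UNIV (\<lambda>x. (1 / h n) *\<^sub>R (\<eta>' (x + h n) - \<eta>' x))"
      by (intro continuous_intros continuous_on_compose2[OF d(4)] d(4)) auto
    show "0 < c / 2" using d(1) by simp
    show "d < l" by fact
    show "\<psi> n x = 0" if "x \<notin> {c/2..d}" for x
      unfolding \<psi>_def using that h[of n] d(6)[of x] d(6)[of "x + h n"] d(1) by auto
  qed
  have bd: "norm (\<psi> n x) \<le> B" for n x
  proof -
    obtain y where "norm (\<eta> (x + h n) - \<eta> x) \<le> norm ((\<lambda>t. t *\<^sub>R \<eta>' y) (x + h n - x))"
      using mvt_general[of x "x + h n" \<eta> "\<lambda>y t. t *\<^sub>R \<eta>' y"] h(1)[of n] c\<eta> d(3)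
      by (auto simp: has_vector_derivative_def)
    also have "\<dots> \<le> h n * B" using h(1)[of n] B'[of y] by (simp add: mult_left_mono)
    finally have "norm (\<eta> (x + h n) - \<eta> x) \<le> h n * B" .
    moreover have "norm (\<psi> n x) = norm (\<eta> (x + h n) - \<eta> x) / h n"
      unfolding \<psi>_def norm_scaleR using h(1)[of n] by simp
    ultimately show ?thesis using h(1)[of n] by (simp add: pos_divide_le_eq mult.commute)
  qed
  have lim: "(\<lambda>n. \<psi> n x) \<longlonglongrightarrow> \<eta>' x" for x
  proof -
    have "filterlim h (at 0) sequentially"
      using h0 h(1) by (simp add: filterlim_at less_imp_neq[symmetric])
    moreover have "((\<lambda>t. (1 / t) *\<^sub>R (\<eta> (x + t) - \<eta> x)) \<longlongrightarrow> \<eta>' x) (at 0)"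
    proof -
      have "((\<lambda>t. norm (\<eta> (x + t) - \<eta> x - t *\<^sub>R \<eta>' x) / norm t) \<longlongrightarrow> 0) (at 0)"
        using d(3)[of x] unfolding has_vector_derivative_def has_derivative_at by auto
      then have "((\<lambda>t. norm ((1 / t) *\<^sub>R (\<eta> (x + t) - \<eta> x) - \<eta>' x)) \<longlongrightarrow> 0) (at 0)"
      proof (rule Lim_transform_eventually)
        have "norm (\<eta> (x + t) - \<eta> x - t *\<^sub>R \<eta>' x) / norm t =
            norm ((1 / t) *\<^sub>R (\<eta> (x + t) - \<eta> x) - \<eta>' x)" if "t \<noteq> 0" for t
        proof -
          have "(1 / t) *\<^sub>R (\<eta> (x + t) - \<eta> x) - \<eta>' x = (1 / t) *\<^sub>R (\<eta> (x + t) - \<eta> x - t *\<^sub>R \<eta>' x)"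
            using that by (simp add: scaleR_diff_right)
          then show ?thesis by (simp add: divide_inverse)
        qed
        then show "\<forall>\<^sub>F t in at 0. norm (\<eta> (x + t) - \<eta> x - t *\<^sub>R \<eta>' x) / norm t =
            norm ((1 / t) *\<^sub>R (\<eta> (x + t) - \<eta> x) - \<eta>' x)"
          by (auto simp: eventually_at_filter)
      qed
      then show ?thesis by (simp add: tendsto_norm_zero_iff LIM_zero_iff)
    qed
    ultimately show ?thesis unfolding \<psi>_def by (rule filterlim_compose[rotated])
  qed
  have "(\<lambda>n. ip l v (\<psi> n)) \<longlonglongrightarrow> ip l v \<eta>'"
    unfolding ip_def
  proof (rule integral_dominated_convergence[where w = "\<lambda>x. norm (v x) * B"])
    show "integrable (meas l) (\<lambda>x. norm (v x) * B)"
    proof (rule integrable_mult_left, rule Bochner_Integration.integrable_bound)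
      have "integrable (meas l) (\<lambda>x. 1::real)" by (rule continuous_on_integrable_meas) auto
      then show "integrable (meas l) (\<lambda>x. 1 + (norm (v x))\<^sup>2)" using v by (auto dest: L2_D)
      show "(\<lambda>x. norm (v x)) \<in> borel_measurable (meas l)" using L2_D(1)[OF v] by measurable
      show "AE x in meas l. norm (norm (v x)) \<le> norm (1 + (norm (v x))\<^sup>2)"
      proof (rule AE_I2)
        fix x
        have "norm (v x) \<le> 1 + (norm (v x))\<^sup>2"
          using sum_squares_bound[of "norm (v x)" 1] norm_ge_zero[of "v x"] unfolding power_one by linarith
        then show "norm (norm (v x)) \<le> norm (1 + (norm (v x))\<^sup>2)" by simp
      qed
    qed
    show "(\<lambda>x. v x \<bullet> \<eta>' x) \<in> borel_measurable (meas l)"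
      using L2_D(1)[OF v] continuous_on_measurable_meas[OF continuous_on_subset[OF d(4)]]
      by (intro borel_measurable_inner) auto
    show "(\<lambda>x. v x \<bullet> \<psi> n x) \<in> borel_measurable (meas l)" for n
      using L2_D(1)[OF v] L2_D(1)[OF test_function_L2(1)[OF \<psi> l]]
      by (intro borel_measurable_inner)
    show "AE x in meas l. (\<lambda>n. v x \<bullet> \<psi> n x) \<longlonglongrightarrow> v x \<bullet> \<eta>' x"
      using lim by (intro AE_I2 tendsto_intros)
    show "AE x in meas l. norm (v x \<bullet> \<psi> n x) \<le> norm (v x) * B" for n
      using bd by (intro AE_I2) (metis Cauchy_Schwarz_ineq2 mult_left_mono norm_ge_zero order_trans real_norm_def)
  qed
  then have "ip l v \<eta>' = 0" using orth[OF \<psi>] by (simp add: LIMSEQ_const_iff)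
  then show ?thesis
    using assms test_function_L2(2)[OF \<eta> l] unfolding d(5)[symmetric, abs_def] v_def
    by (simp add: ip_linear)
qed

section \<open>The Dirichlet operators and their quadratic forms\<close>

lemma L2_norm_triangle:
  fixes u v :: "real \<Rightarrow> 'a::euclidean_space"
  assumes "u \<in> L2 l" "v \<in> L2 l"
  shows "L2_norm l (\<lambda>x. u x + v x) \<le> L2_norm l u + L2_norm l v"
proof (rule power2_le_imp_le)
  have "(L2_norm l (\<lambda>x. u x + v x))\<^sup>2 = (L2_norm l u)\<^sup>2 + 2 * ip l u v + (L2_norm l v)\<^sup>2"
    using assms by (simp add: L2_norm_sq ip_linear L2_add ip_commute[of l v u])
  also have "\<dots> \<le> (L2_norm l u + L2_norm l v)\<^sup>2"
    using ip_Cauchy_Schwarz[OF assms] by (simp add: power2_sum)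
  finally show "(L2_norm l (\<lambda>x. u x + v x))\<^sup>2 \<le> (L2_norm l u + L2_norm l v)\<^sup>2" .
qed (simp add: L2_norm_nonneg)

lemma L2_norm_scaleR: "L2_norm l (\<lambda>x. c *\<^sub>R u x) = \<bar>c\<bar> * L2_norm l u"
  by (simp add: L2_norm_def power_mult_distrib real_sqrt_mult)

lemma H1_0_sequence:
  assumes "v \<in> L2 l" "\<forall>\<epsilon>>0. \<exists>\<eta>\<in>test_functions l.
        sqrt ((L2_norm l (\<lambda>x. u x - \<eta> x))\<^sup>2
            + (L2_norm l (\<lambda>x. v x - vector_derivative \<eta> (at x)))\<^sup>2) < \<epsilon>"
  obtains \<eta> where "\<And>n::nat. \<eta> n \<in> test_functions l"
    "(\<lambda>n. L2_norm l (\<lambda>x. u x - \<eta> n x)) \<longlonglongrightarrow> 0"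
    "(\<lambda>n. L2_norm l (\<lambda>x. v x - vector_derivative (\<eta> n) (at x))) \<longlonglongrightarrow> 0"
proof -
  have "\<exists>\<eta>\<in>test_functions l. sqrt ((L2_norm l (\<lambda>x. u x - \<eta> x))\<^sup>2
            + (L2_norm l (\<lambda>x. v x - vector_derivative \<eta> (at x)))\<^sup>2) < 1 / real (Suc n)" for n
    using assms(2) by simp
  then obtain \<eta> where \<eta>: "\<And>n. \<eta> n \<in> test_functions l"
    "\<And>n. sqrt ((L2_norm l (\<lambda>x. u x - \<eta> n x))\<^sup>2
            + (L2_norm l (\<lambda>x. v x - vector_derivative (\<eta> n) (at x)))\<^sup>2) < 1 / real (Suc n)"
    by metis
  have lim: "(\<lambda>n. 1 / real (Suc n)) \<longlonglongrightarrow> 0"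
    using LIMSEQ_Suc[OF lim_1_over_n] by simp
  show ?thesis
  proof (rule that[OF \<eta>(1)])
    show "(\<lambda>n. L2_norm l (\<lambda>x. u x - \<eta> n x)) \<longlonglongrightarrow> 0"
    proof (rule real_tendsto_sandwich[OF _ _ tendsto_const lim])
      show "\<forall>\<^sub>F n in sequentially. L2_norm l (\<lambda>x. u x - \<eta> n x) \<le> 1 / real (Suc n)"
        by (intro always_eventually allI order_trans[OF real_sqrt_sum_squares_ge1 less_imp_le[OF \<eta>(2)]])
    qed (simp add: L2_norm_nonneg)
    show "(\<lambda>n. L2_norm l (\<lambda>x. v x - vector_derivative (\<eta> n) (at x))) \<longlonglongrightarrow> 0"
    proof (rule real_tendsto_sandwich[OF _ _ tendsto_const lim])
      show "\<forall>\<^sub>F n in sequentially. L2_norm l (\<lambda>x. v x - vector_derivative (\<eta> n) (at x)) \<le> 1 / real (Suc n)"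
        by (intro always_eventually allI order_trans[OF real_sqrt_sum_squares_ge2 less_imp_le[OF \<eta>(2)]])
    qed (simp add: L2_norm_nonneg)
  qed
qed

lemma H1_0_I:
  assumes "u \<in> L2 l" "v \<in> L2 l" "weak_deriv l u v" "\<And>n::nat. \<eta> n \<in> test_functions l"
    and lim: "(\<lambda>n. L2_norm l (\<lambda>x. u x - \<eta> n x)) \<longlonglongrightarrow> 0"
      "(\<lambda>n. L2_norm l (\<lambda>x. v x - vector_derivative (\<eta> n) (at x))) \<longlonglongrightarrow> 0"
  shows "u \<in> H1_0 l"
proof -
  have "\<exists>\<eta>\<in>test_functions l. sqrt ((L2_norm l (\<lambda>x. u x - \<eta> x))\<^sup>2
            + (L2_norm l (\<lambda>x. v x - vector_derivative \<eta> (at x)))\<^sup>2) < \<epsilon>" if "\<epsilon> > 0" for \<epsilon>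
  proof -
    have "(\<lambda>n. sqrt ((L2_norm l (\<lambda>x. u x - \<eta> n x))\<^sup>2
            + (L2_norm l (\<lambda>x. v x - vector_derivative (\<eta> n) (at x)))\<^sup>2)) \<longlonglongrightarrow> sqrt (0\<^sup>2 + 0\<^sup>2)"
      by (intro tendsto_intros lim)
    then have "\<forall>\<^sub>F n in sequentially. sqrt ((L2_norm l (\<lambda>x. u x - \<eta> n x))\<^sup>2
            + (L2_norm l (\<lambda>x. v x - vector_derivative (\<eta> n) (at x)))\<^sup>2) < \<epsilon>"
      by (rule order_tendstoD(2)) (use that in simp)
    then show ?thesis using assms(4) by (auto simp: eventually_sequentially)
  qed
  then show ?thesis using assms unfolding H1_0_def H1_def by blast
qed

text \<open>
  Membership in $H^1_0$ fixes the weak derivative only almost everywhere; one representative is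
  selected, together with its approximability by derivatives of test functions.
\<close>

definition grad :: "real \<Rightarrow> (real \<Rightarrow> complex) \<Rightarrow> real \<Rightarrow> complex" where
  "grad l u = (SOME v. v \<in> L2 l \<and> weak_deriv l u v \<and>
     (\<forall>\<epsilon>>0. \<exists>\<eta>\<in>test_functions l.
        sqrt ((L2_norm l (\<lambda>x. u x - \<eta> x))\<^sup>2
            + (L2_norm l (\<lambda>x. v x - vector_derivative \<eta> (at x)))\<^sup>2) < \<epsilon>))"

lemma grad:
  assumes "u \<in> H1_0 l"
  shows "u \<in> L2 l" "grad l u \<in> L2 l" "weak_deriv l u (grad l u)"
    and grad_approx: "\<exists>\<eta>. (\<forall>n::nat. \<eta> n \<in> test_functions l) \<and>
      (\<lambda>n. L2_norm l (\<lambda>x. u x - \<eta> n x)) \<longlonglongrightarrow> 0 \<and>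
      (\<lambda>n. L2_norm l (\<lambda>x. grad l u x - vector_derivative (\<eta> n) (at x))) \<longlonglongrightarrow> 0"
proof -
  have "\<exists>v. v \<in> L2 l \<and> weak_deriv l u v \<and>
     (\<forall>\<epsilon>>0. \<exists>\<eta>\<in>test_functions l.
        sqrt ((L2_norm l (\<lambda>x. u x - \<eta> x))\<^sup>2
            + (L2_norm l (\<lambda>x. v x - vector_derivative \<eta> (at x)))\<^sup>2) < \<epsilon>)"
    using assms unfolding H1_0_def by blast
  from someI_ex[OF this, folded grad_def]
  have g: "grad l u \<in> L2 l" "weak_deriv l u (grad l u)"
    "\<forall>\<epsilon>>0. \<exists>\<eta>\<in>test_functions l.
        sqrt ((L2_norm l (\<lambda>x. u x - \<eta> x))\<^sup>2
            + (L2_norm l (\<lambda>x. grad l u x - vector_derivative \<eta> (at x)))\<^sup>2) < \<epsilon>"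
    by blast+
  show "grad l u \<in> L2 l" "weak_deriv l u (grad l u)" by (fact g)+
  show "\<exists>\<eta>. (\<forall>n::nat. \<eta> n \<in> test_functions l) \<and>
      (\<lambda>n. L2_norm l (\<lambda>x. u x - \<eta> n x)) \<longlonglongrightarrow> 0 \<and>
      (\<lambda>n. L2_norm l (\<lambda>x. grad l u x - vector_derivative (\<eta> n) (at x))) \<longlonglongrightarrow> 0"
    by (rule H1_0_sequence[OF g(1,3)]) blast
  show "u \<in> L2 l" using assms by (simp add: H1_0_def H1_def)
qed

lemma dirichlet_op_L2:
  assumes "(u, a) \<in> dirichlet_op l q"
  shows "u \<in> L2 l" "a \<in> L2 l" "u \<in> H1_0 l"
  using assms by (auto simp: dirichlet_op_def H1_0_def H1_def)

lemma dirichlet_op_I: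
  assumes "u \<in> L2 l" "u1 \<in> L2 l" "u2 \<in> L2 l" "a \<in> L2 l"
    and "weak_deriv l u u1" "weak_deriv l u1 u2" "u \<in> H1_0 l"
    and "AE x in meas l. a x = - u2 x - of_real (q x) * u x"
  shows "(u, a) \<in> dirichlet_op l q"
  using assms unfolding dirichlet_op_def H2_def H1_def by blast

text \<open>
  Integration by parts. It holds for a test function in place of \<open>y\<close> by the definition of the weak
  derivative, and both sides are continuous in \<open>y\<close> with respect to the norm of $H^1$. Uniqueness of weak derivatives
  replaces the derivative that belongs to the operator by the selected \<^const>\<open>grad\<close>, which is what
  makes the form symmetric.
\<close>

lemma dirichlet_form:
  assumes "(u, a) \<in> dirichlet_op l q" "y \<in> H1_0 l" "continuous_on {0..l} q" and l: "l > 0"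
  shows "ip l a y = ip l (grad l u) (grad l y) - ip l (\<lambda>x. of_real (q x) * u x) y"
proof -
  note ua = dirichlet_op_L2[OF assms(1)]
  obtain u1 u2 where u: "u1 \<in> L2 l" "u2 \<in> L2 l" "weak_deriv l u u1" "weak_deriv l u1 u2"
      "AE x in meas l. a x = - u2 x - of_real (q x) * u x"
    using assms(1) unfolding dirichlet_op_def by blast
  note gy = grad(1-3)[OF assms(2)] and gu = grad(1-3)[OF ua(3)]
  obtain \<eta> where \<eta>: "\<And>n::nat. \<eta> n \<in> test_functions l"
      "(\<lambda>n. L2_norm l (\<lambda>x. y x - \<eta> n x)) \<longlonglongrightarrow> 0"
      "(\<lambda>n. L2_norm l (\<lambda>x. grad l y x - vector_derivative (\<eta> n) (at x))) \<longlonglongrightarrow> 0"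
    using grad_approx[OF assms(2)] by blast
  have z: "(\<lambda>n. L2_norm l (\<lambda>x. w x - w x)) \<longlonglongrightarrow> 0" for w :: "real \<Rightarrow> complex"
    by (simp add: L2_norm_def)
  have "(\<lambda>n. ip l u2 (\<eta> n)) \<longlonglongrightarrow> ip l u2 y"
    by (rule ip_tendsto[OF u(2) gy(1) u(2) test_function_L2(1)[OF \<eta>(1) l] z \<eta>(2)])
  moreover have "ip l u2 (\<eta> n) = - ip l (grad l u) (\<lambda>x. vector_derivative (\<eta> n) (at x))" for n
    using weak_deriv_ip[OF u(4) u(1,2) \<eta>(1) l]
      weak_deriv_ip_unique[OF u(3) gu(3) ua(1) u(1) gu(2) \<eta>(1) l] by simp
  moreover have "(\<lambda>n. - ip l (grad l u) (\<lambda>x. vector_derivative (\<eta> n) (at x))) \<longlonglongrightarrow> - ip l (grad l u) (grad l y)"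
    by (intro tendsto_minus ip_tendsto[OF gu(2) gy(2) gu(2) test_function_L2(2)[OF \<eta>(1) l] z \<eta>(3)])
  ultimately have eq: "ip l u2 y = - ip l (grad l u) (grad l y)"
    using LIMSEQ_unique by simp
  have qu: "(\<lambda>x. of_real (q x) * u x) \<in> L2 l" by (rule L2_mult_continuous[OF ua(1) assms(3)])
  have "ip l a y = ip l (\<lambda>x. - u2 x - of_real (q x) * u x) y"
    by (rule ip_cong_AE[OF ua(2) L2_diff[OF L2_uminus[OF u(2)] qu] gy(1) u(5)])
  also have "\<dots> = - ip l u2 y - ip l (\<lambda>x. of_real (q x) * u x) y"
    using ip_linear(2)[OF L2_uminus[OF u(2)] qu gy(1)] by simp
  finally show ?thesis using eq by simp
qed

lemma dirichlet_symmetric: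
  assumes "(u, a) \<in> dirichlet_op l q" "(y, b) \<in> dirichlet_op l q" "continuous_on {0..l} q" "l > 0"
  shows "ip l a y = ip l u b"
proof -
  have "ip l (\<lambda>x. of_real (q x) * u x) y = ip l (\<lambda>x. of_real (q x) * y x) u"
    by (simp add: ip_def inner_complex_def algebra_simps)
  then show ?thesis
    using dirichlet_form[OF assms(1) dirichlet_op_L2(3)[OF assms(2)] assms(3,4)]
      dirichlet_form[OF assms(2) dirichlet_op_L2(3)[OF assms(1)] assms(3,4)]
    by (simp add: ip_commute)
qed

text \<open>
  The operators for different bounded potentials have the same domain. This is how $L_+$ is
  compared with $L_-$.
\<close>

lemma dirichlet_change_potential:
  assumes "(u, a) \<in> dirichlet_op l q" "continuous_on {0..l} q" "continuous_on {0..l} p"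
  shows "(u, \<lambda>x. a x + of_real (q x - p x) * u x) \<in> dirichlet_op l p"
proof -
  obtain u1 u2 where u: "u1 \<in> L2 l" "u2 \<in> L2 l" "weak_deriv l u u1" "weak_deriv l u1 u2"
      "AE x in meas l. a x = - u2 x - of_real (q x) * u x"
    using assms(1) unfolding dirichlet_op_def by blast
  have "(\<lambda>x. a x + of_real (q x - p x) * u x) \<in> L2 l"
    by (rule L2_add[OF dirichlet_op_L2(2)[OF assms(1)]
          L2_mult_continuous[OF dirichlet_op_L2(1)[OF assms(1)] continuous_on_diff[OF assms(2,3)]]])
  moreover have "AE x in meas l. a x + of_real (q x - p x) * u x = - u2 x - of_real (p x) * u x"
    using u(5) by eventually_elim (simp add: algebra_simps)
  moreover have "u \<in> H2 l \<inter> H1_0 l" using assms(1) by (simp add: dirichlet_op_def)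
  ultimately show ?thesis using u(1-4) unfolding dirichlet_op_def by blast
qed

lemma weak_deriv_lincomb:
  fixes t :: real
  assumes "weak_deriv l u v" "weak_deriv l u' v'" and L: "u \<in> L2 l" "v \<in> L2 l" "u' \<in> L2 l" "v' \<in> L2 l"
    and l: "l > 0"
  shows "weak_deriv l (\<lambda>x. u x + t *\<^sub>R u' x) (\<lambda>x. v x + t *\<^sub>R v' x)"
  unfolding weak_deriv_def
proof
  fix \<eta> assume \<eta>: "\<eta> \<in> test_functions l"
  note T = test_function_L2[OF \<eta> l]
  have *: "(\<integral>x. (p x + t *\<^sub>R p' x) * z x \<partial>(meas l)) = (\<integral>x. p x * z x \<partial>(meas l)) + t *\<^sub>R (\<integral>x. p' x * z x \<partial>(meas l))"
    if "p \<in> L2 l" "p' \<in> L2 l" "z \<in> L2 l" for p p' z :: "real \<Rightarrow> complex"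
  proof -
    have "(\<integral>x. (p x + t *\<^sub>R p' x) * z x \<partial>(meas l)) = (\<integral>x. p x * z x + t *\<^sub>R (p' x * z x) \<partial>(meas l))"
      by (simp only: distrib_right mult_scaleR_left)
    also have "\<dots> = (\<integral>x. p x * z x \<partial>(meas l)) + (\<integral>x. t *\<^sub>R (p' x * z x) \<partial>(meas l))"
      by (intro Bochner_Integration.integral_add integrable_scaleR_right L2_mult_integrable that)
    finally show ?thesis by (simp only: integral_scaleR_right)
  qed
  have "(\<integral>x. u x * vector_derivative \<eta> (at x) \<partial>(meas l)) = - (\<integral>x. v x * \<eta> x \<partial>(meas l))"
    "(\<integral>x. u' x * vector_derivative \<eta> (at x) \<partial>(meas l)) = - (\<integral>x. v' x * \<eta> x \<partial>(meas l))"
    using assms(1,2) \<eta> unfolding weak_deriv_def by blast+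
  then show "(\<integral>x. (u x + t *\<^sub>R u' x) * vector_derivative \<eta> (at x) \<partial>(meas l)) = - (\<integral>x. (v x + t *\<^sub>R v' x) * \<eta> x \<partial>(meas l))"
    unfolding *[OF L(1,3) T(2)] *[OF L(2,4) T(1)] by simp
qed

lemma test_function_lincomb:
  fixes t :: real
  assumes "\<eta> \<in> test_functions l" "\<zeta> \<in> test_functions l" "l > 0"
  shows "(\<lambda>x. \<eta> x + t *\<^sub>R \<zeta> x) \<in> test_functions l"
    "vector_derivative (\<lambda>x. \<eta> x + t *\<^sub>R \<zeta> x) (at x) = vector_derivative \<eta> (at x) + t *\<^sub>R vector_derivative \<zeta> (at x)"
proof -
  obtain \<eta>' c d where d: "0 < c" "d < l" "\<And>x. (\<eta> has_vector_derivative \<eta>' x) (at x)"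
    "continuous_on UNIV \<eta>'" "\<And>x. vector_derivative \<eta> (at x) = \<eta>' x" "\<And>x. x \<notin> {c..d} \<Longrightarrow> \<eta> x = 0"
    using test_functionE[OF assms(1,3)] by metis
  obtain \<zeta>' c' d' where d': "0 < c'" "d' < l" "\<And>x. (\<zeta> has_vector_derivative \<zeta>' x) (at x)"
    "continuous_on UNIV \<zeta>'" "\<And>x. vector_derivative \<zeta> (at x) = \<zeta>' x" "\<And>x. x \<notin> {c'..d'} \<Longrightarrow> \<zeta> x = 0"
    using test_functionE[OF assms(2,3)] by metis
  have der: "((\<lambda>x. \<eta> x + t *\<^sub>R \<zeta> x) has_vector_derivative \<eta>' x + t *\<^sub>R \<zeta>' x) (at x)" for x
    by (intro has_vector_derivative_add d(3)
        bounded_linear.has_vector_derivative[OF bounded_linear_scaleR_right d'(3)])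
  then show "vector_derivative (\<lambda>x. \<eta> x + t *\<^sub>R \<zeta> x) (at x) = vector_derivative \<eta> (at x) + t *\<^sub>R vector_derivative \<zeta> (at x)"
    using d(5) d'(5) vector_derivative_at by metis
  show "(\<lambda>x. \<eta> x + t *\<^sub>R \<zeta> x) \<in> test_functions l"
  proof (rule test_functionI[OF der])
    show "continuous_on UNIV (\<lambda>x. \<eta>' x + t *\<^sub>R \<zeta>' x)" using d(4) d'(4) by (intro continuous_intros)
    show "0 < min c c'" "max d d' < l" using d d' by auto
    show "\<eta> x + t *\<^sub>R \<zeta> x = 0" if "x \<notin> {min c c'..max d d'}" for x
    proof -
      have "x \<notin> {c..d}" "x \<notin> {c'..d'}" using that by (auto simp: min_le_iff_disj le_max_iff_disj)
      then show ?thesis using d(6)[of x] d'(6)[of x] by simp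
    qed
  qed
qed

lemma H1_0_lincomb:
  fixes t :: real
  assumes "u \<in> H1_0 l" "y \<in> H1_0 l" and l: "l > 0"
  shows "(\<lambda>x. u x + t *\<^sub>R y x) \<in> H1_0 l"
proof -
  note gu = grad(1-3)[OF assms(1)] and gy = grad(1-3)[OF assms(2)]
  obtain \<eta> where \<eta>: "\<And>n::nat. \<eta> n \<in> test_functions l"
      "(\<lambda>n. L2_norm l (\<lambda>x. u x - \<eta> n x)) \<longlonglongrightarrow> 0"
      "(\<lambda>n. L2_norm l (\<lambda>x. grad l u x - vector_derivative (\<eta> n) (at x))) \<longlonglongrightarrow> 0"
    using grad_approx[OF assms(1)] by blast
  obtain \<zeta> where \<zeta>: "\<And>n::nat. \<zeta> n \<in> test_functions l"
      "(\<lambda>n. L2_norm l (\<lambda>x. y x - \<zeta> n x)) \<longlonglongrightarrow> 0"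
      "(\<lambda>n. L2_norm l (\<lambda>x. grad l y x - vector_derivative (\<zeta> n) (at x))) \<longlonglongrightarrow> 0"
    using grad_approx[OF assms(2)] by blast
  have *: "(\<lambda>n. L2_norm l (\<lambda>x. (p x + t *\<^sub>R p' x) - (P n x + t *\<^sub>R P' n x))) \<longlonglongrightarrow> 0"
    if "p \<in> L2 l" "p' \<in> L2 l" "\<And>n. P n \<in> L2 l" "\<And>n. P' n \<in> L2 l"
      "(\<lambda>n. L2_norm l (\<lambda>x. p x - P n x)) \<longlonglongrightarrow> 0" "(\<lambda>n. L2_norm l (\<lambda>x. p' x - P' n x)) \<longlonglongrightarrow> 0"
    for p p' :: "real \<Rightarrow> complex" and P P' :: "nat \<Rightarrow> real \<Rightarrow> complex"
  proof (rule real_tendsto_sandwich[OF _ _ tendsto_const])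
    show "(\<lambda>n. L2_norm l (\<lambda>x. p x - P n x) + \<bar>t\<bar> * L2_norm l (\<lambda>x. p' x - P' n x)) \<longlonglongrightarrow> 0"
      using that(5,6) by (auto intro!: tendsto_eq_intros)
    show "\<forall>\<^sub>F n in sequentially. L2_norm l (\<lambda>x. (p x + t *\<^sub>R p' x) - (P n x + t *\<^sub>R P' n x))
        \<le> L2_norm l (\<lambda>x. p x - P n x) + \<bar>t\<bar> * L2_norm l (\<lambda>x. p' x - P' n x)"
    proof (rule always_eventually, rule allI)
      fix n
      have "(\<lambda>x. (p x + t *\<^sub>R p' x) - (P n x + t *\<^sub>R P' n x)) = (\<lambda>x. (p x - P n x) + t *\<^sub>R (p' x - P' n x))"
        by (simp add: algebra_simps)
      then show "L2_norm l (\<lambda>x. (p x + t *\<^sub>R p' x) - (P n x + t *\<^sub>R P' n x))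
          \<le> L2_norm l (\<lambda>x. p x - P n x) + \<bar>t\<bar> * L2_norm l (\<lambda>x. p' x - P' n x)"
        using L2_norm_triangle[OF L2_diff[OF that(1,3)] L2_scaleR[OF L2_diff[OF that(2,4)]], of n t n]
        by (simp only: L2_norm_scaleR)
    qed
  qed (simp add: L2_norm_nonneg)
  show ?thesis
  proof (rule H1_0_I)
    show "(\<lambda>x. u x + t *\<^sub>R y x) \<in> L2 l" "(\<lambda>x. grad l u x + t *\<^sub>R grad l y x) \<in> L2 l"
      using gu(1,2) gy(1,2) by (simp_all only: L2_add L2_scaleR)
    show "weak_deriv l (\<lambda>x. u x + t *\<^sub>R y x) (\<lambda>x. grad l u x + t *\<^sub>R grad l y x)"
      by (rule weak_deriv_lincomb[OF gu(3) gy(3) gu(1,2) gy(1,2) l])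
    show "(\<lambda>x. \<eta> n x + t *\<^sub>R \<zeta> n x) \<in> test_functions l" for n
      by (rule test_function_lincomb[OF \<eta>(1) \<zeta>(1) l])
    show "(\<lambda>n. L2_norm l (\<lambda>x. u x + t *\<^sub>R y x - (\<eta> n x + t *\<^sub>R \<zeta> n x))) \<longlonglongrightarrow> 0"
      by (rule *[OF gu(1) gy(1) test_function_L2(1)[OF \<eta>(1) l] test_function_L2(1)[OF \<zeta>(1) l] \<eta>(2) \<zeta>(2)])
    show "(\<lambda>n. L2_norm l (\<lambda>x. grad l u x + t *\<^sub>R grad l y x
        - vector_derivative (\<lambda>x. \<eta> n x + t *\<^sub>R \<zeta> n x) (at x))) \<longlonglongrightarrow> 0"
      unfolding test_function_lincomb(2)[OF \<eta>(1) \<zeta>(1) l]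
      by (rule *[OF gu(2) gy(2) test_function_L2(2)[OF \<eta>(1) l] test_function_L2(2)[OF \<zeta>(1) l] \<eta>(3) \<zeta>(3)])
  qed
qed

lemma dirichlet_lincomb:
  fixes t :: real
  assumes "(u, a) \<in> dirichlet_op l q" "(y, b) \<in> dirichlet_op l q" and l: "l > 0"
  shows "(\<lambda>x. u x + t *\<^sub>R y x, \<lambda>x. a x + t *\<^sub>R b x) \<in> dirichlet_op l q"
proof -
  note U = dirichlet_op_L2[OF assms(1)] and Y = dirichlet_op_L2[OF assms(2)]
  obtain u1 u2 where u: "u1 \<in> L2 l" "u2 \<in> L2 l" "weak_deriv l u u1" "weak_deriv l u1 u2"
      "AE x in meas l. a x = - u2 x - of_real (q x) * u x"
    using assms(1) unfolding dirichlet_op_def by blast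
  obtain y1 y2 where y: "y1 \<in> L2 l" "y2 \<in> L2 l" "weak_deriv l y y1" "weak_deriv l y1 y2"
      "AE x in meas l. b x = - y2 x - of_real (q x) * y x"
    using assms(2) unfolding dirichlet_op_def by blast
  note w1 = weak_deriv_lincomb[OF u(3) y(3) U(1) u(1) Y(1) y(1) l, of t]
  note w2 = weak_deriv_lincomb[OF u(4) y(4) u(1,2) y(1,2) l, of t]
  have L: "(\<lambda>x. u x + t *\<^sub>R y x) \<in> L2 l" "(\<lambda>x. u1 x + t *\<^sub>R y1 x) \<in> L2 l"
      "(\<lambda>x. u2 x + t *\<^sub>R y2 x) \<in> L2 l" "(\<lambda>x. a x + t *\<^sub>R b x) \<in> L2 l"
    using U(1,2) Y(1,2) u(1,2) y(1,2) by (simp_all only: L2_add L2_scaleR)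
  have A: "AE x in meas l. a x + t *\<^sub>R b x = - (u2 x + t *\<^sub>R y2 x) - of_real (q x) * (u x + t *\<^sub>R y x)"
    using u(5) y(5)
  proof eventually_elim
    case (elim x)
    then have "a x + t *\<^sub>R b x = (- u2 x - of_real (q x) * u x) + t *\<^sub>R (- y2 x - of_real (q x) * y x)"
      by (simp only:)
    also have "\<dots> = - (u2 x + t *\<^sub>R y2 x) - of_real (q x) * (u x + t *\<^sub>R y x)"
      by (simp only: scaleR_diff_right scaleR_minus_right distrib_left mult_scaleR_right) simp
    finally show ?case .
  qed
  show ?thesis
    by (rule dirichlet_op_I[OF L w1 w2 H1_0_lincomb[OF U(3) Y(3) l] A])
qed

section \<open>Classical functions in the operator domain\<close>

lemma test_function_of_derivative:
  fixes v :: "real \<Rightarrow> complex"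
  assumes cont: "continuous_on UNIV v" and cd: "0 < c" "c < d" "d < l"
    and z: "\<And>x. x \<notin> {c..d} \<Longrightarrow> v x = 0" and mean: "(\<integral>x. v x \<partial>(meas l)) = 0"
  obtains \<eta> where "\<eta> \<in> test_functions l" "\<And>x. (\<eta> has_vector_derivative v x) (at x)" "\<eta> 0 = 0"
proof -
  define \<eta> where "\<eta> x = integral {0..x} v" for x
  have contS: "continuous_on S v" for S using cont continuous_on_subset by blast
  have low: "\<eta> x = 0" if "x < c" for x
  proof -
    have "integral {0..x} v = integral {0..x} (\<lambda>_. 0)"
      by (rule integral_cong) (use that z in auto)
    then show ?thesis by (simp add: \<eta>_def)
  qed
  have der: "(\<eta> has_vector_derivative v x) (at x)" for x
  proof (cases "x < c")
    case True
    have "((\<lambda>_. 0) has_vector_derivative 0) (at x)" by simp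
    then have "(\<eta> has_vector_derivative 0) (at x)"
      by (rule has_vector_derivative_transform_within_open[of _ _ _ "{..<c}"]) (use True low in auto)
    then show ?thesis using z[of x] True by simp
  next
    case False
    have "(\<eta> has_vector_derivative v x) (at x within {0..x+1})"
      unfolding \<eta>_def by (rule integral_has_vector_derivative[OF contS]) (use False cd in auto)
    moreover have "at x within {0..x+1} = at x"
      by (rule at_within_interior) (use False cd in simp)
    ultimately show ?thesis by (simp only:)
  qed
  have const: "\<eta> x = \<eta> d" if "x > d" for x
  proof -
    have "integral {0..d} v + integral {d..x} v = integral {0..x} v"
      by (rule Henstock_Kurzweil_Integration.integral_combine)
         (use that cd in \<open>auto intro!: integrable_continuous_real contS\<close>)
    moreover have "integral {d..x} v = integral {d..x} (\<lambda>_. 0)"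
      by (rule integral_spike[of "{d}"]) (use z in auto)
    ultimately show ?thesis by (simp add: \<eta>_def)
  qed
  have "\<eta> l - \<eta> 0 = (\<integral>x. v x \<partial>(meas l))"
    by (rule integral_meas_FTC[symmetric]) (use cd in \<open>auto intro: has_vector_derivative_at_within der contS\<close>)
  then have "\<eta> l = 0" using mean low[of 0] cd by simp
  then have "\<eta> x = 0" if "x > d" for x using const[OF that] const[OF cd(3)] by simp
  then have "\<eta> \<in> test_functions l"
    by (intro test_functionI[OF der cont cd(1,3)]) (use low in force)
  then show ?thesis using that[of \<eta>] der low[of 0] cd by simp
qed

lemma L2_norm_le_bound:
  fixes u :: "real \<Rightarrow> 'a::euclidean_space"
  assumes "u \<in> L2 l" "\<And>x. x \<in> {0<..<l} \<Longrightarrow> norm (u x) \<le> B" "l > 0" "B \<ge> 0"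
  shows "L2_norm l u \<le> sqrt l * B"
proof -
  have "(\<integral>x. (norm (u x))\<^sup>2 \<partial>(meas l)) \<le> (\<integral>x. B\<^sup>2 \<partial>(meas l))"
    by (rule integral_mono[OF L2_D(2)[OF assms(1)] continuous_on_integrable_meas power_mono])
       (use assms in auto)
  also have "(\<integral>x. B\<^sup>2 \<partial>(meas l)) = l * B\<^sup>2"
  proof -
    have "((\<lambda>x. B\<^sup>2 * x) has_vector_derivative B\<^sup>2) (at x within {0..l})" for x
      by (auto intro!: derivative_eq_intros simp flip: has_real_derivative_iff_has_vector_derivative)
    from integral_meas_FTC[OF less_imp_le[OF assms(3)] this] show ?thesis by simp
  qed
  finally have "L2_norm l u \<le> sqrt (l * B\<^sup>2)" unfolding L2_norm_def by (rule real_sqrt_le_mono)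
  then show ?thesis using assms(4) by (simp add: real_sqrt_mult)
qed

text \<open>
  The approximating test functions are built from their derivatives: \<open>u'\<close> is multiplied by a
  continuous cutoff \<open>\<psi> n\<close>, a fixed bump \<open>\<kappa>\<close> restores mean value zero, and the result is integrated.
  Cutting off \<open>u'\<close> rather than \<open>u\<close> means that no derivative of the cutoff has to be controlled. The
  correction tends to zero because \<open>u'\<close> itself has mean \<open>u l - u 0 = 0\<close>.
\<close>

lemma H1_0_classical:
  fixes u :: "real \<Rightarrow> complex"
  assumes l: "l > 0" and der: "\<And>x. x \<in> {0..l} \<Longrightarrow> (u has_vector_derivative u' x) (at x within {0..l})"
    and cont: "continuous_on {0..l} u'" and bc: "u 0 = 0" "u l = 0"
  shows "u \<in> H1_0 l"
proof -
  have cu: "continuous_on {0..l} u"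
    using der by (meson continuous_on_eq_continuous_within has_vector_derivative_continuous)
  \<comment> \<open>Test functions live on the whole line, so the derivative is first extended continuously.\<close>
  obtain w where cw: "continuous_on UNIV w" and w: "\<And>x. x \<in> {0..l} \<Longrightarrow> w x = u' x"
  proof -
    have "continuous_on UNIV (\<lambda>x. u' (max 0 (min l x)))"
      by (rule continuous_on_compose2[OF cont]) (use l in \<open>auto intro!: continuous_intros\<close>)
    then show ?thesis using that by fastforce
  qed
  obtain B where B: "B > 0" "\<And>x. x \<in> {0..l} \<Longrightarrow> norm (u' x) \<le> B"
    using continuous_on_interval_bound[OF cont] by blast
  define \<psi> where "\<psi> n x = max 0 (min 1 (real n * min x (l - x) - 1))" for n x
  have \<psi>01: "0 \<le> \<psi> n x" "\<psi> n x \<le> 1" for n x by (auto simp: \<psi>_def)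
  have c\<psi>: "continuous_on S (\<psi> n)" for S n unfolding \<psi>_def by (intro continuous_intros)
  define \<kappa> where "\<kappa> x = max 0 (min (x - l / 4) (3 * l / 4 - x))" for x :: real
  have c\<kappa>: "continuous_on S \<kappa>" for S unfolding \<kappa>_def by (intro continuous_intros) auto
  have \<kappa>b: "0 \<le> \<kappa> x" "x \<in> {0..l} \<Longrightarrow> \<kappa> x \<le> l" for x using l by (auto simp: \<kappa>_def)
  define k where "k = (\<integral>x. \<kappa> x \<partial>(meas l))"
  have k: "k > 0"
  proof -
    have "k \<ge> 0" unfolding k_def using \<kappa>b(1) by simp
    moreover have "k \<noteq> 0"
    proof
      assume "k = 0"
      have "(\<kappa> has_integral k) {0<..<l}"
        unfolding k_def by (rule has_integral_integral_lebesgue_on) (auto intro: continuous_on_integrable_meas c\<kappa>)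
      then have "(\<kappa> has_integral 0) (cbox 0 l)"
        using \<open>k = 0\<close> by (simp add: has_integral_Icc_iff_Ioo)
      then have "\<kappa> (l/2) = 0"
        by (rule has_integral_0_cbox_imp_0[OF c\<kappa> \<kappa>b(1)]) (use l in auto)
      then show False using l by (simp add: \<kappa>_def)
    qed
    ultimately show ?thesis by simp
  qed
  have c\<psi>w: "continuous_on {0..l} (\<lambda>x. \<psi> n x *\<^sub>R w x)" for n
    by (rule continuous_on_scaleR[OF c\<psi> continuous_on_subset[OF cw]]) simp
  have cw': "continuous_on {0..l} w" by (rule continuous_on_subset[OF cw]) simp
  define s where "s n = (\<integral>x. \<psi> n x *\<^sub>R w x \<partial>(meas l))" for n
  have \<psi>lim: "(\<lambda>n. \<psi> n x) \<longlonglongrightarrow> 1" if "x \<in> {0<..<l}" for x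
  proof (rule tendsto_eventually)
    have "0 < min x (l - x)" using that by simp
    from reals_Archimedean3[OF this] obtain N :: nat where N: "2 < real N * min x (l - x)"
      by blast
    have "\<psi> n x = 1" if "n \<ge> N" for n
    proof -
      have "real N * min x (l - x) \<le> real n * min x (l - x)"
        using \<open>x \<in> _\<close> that by (intro mult_right_mono) auto
      then show ?thesis using N by (simp add: \<psi>_def)
    qed
    then show "\<forall>\<^sub>F n in sequentially. \<psi> n x = 1" by (auto simp: eventually_sequentially)
  qed
  have wb: "norm (w x) \<le> B" if "x \<in> {0<..<l}" for x using B(2)[of x] w[of x] that by simp
  have sb: "norm (\<psi> n x *\<^sub>R w x) \<le> B" if "x \<in> {0<..<l}" for n x
  proof -
    have "\<psi> n x * norm (w x) \<le> 1 * norm (w x)" by (rule mult_right_mono[OF \<psi>01(2)]) simp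
    then show ?thesis using wb[OF that] \<psi>01(1)[of n x] by simp
  qed
  have slim: "s \<longlonglongrightarrow> 0"
  proof -
    have "(\<lambda>n. s n) \<longlonglongrightarrow> (\<integral>x. w x \<partial>(meas l))"
      unfolding s_def
    proof (rule integral_dominated_convergence[where w = "\<lambda>_. B"])
      show "AE x in meas l. (\<lambda>n. \<psi> n x *\<^sub>R w x) \<longlonglongrightarrow> w x"
      proof (rule AE_I2)
        fix x assume "x \<in> space (meas l)"
        then have "(\<lambda>n. \<psi> n x *\<^sub>R w x) \<longlonglongrightarrow> 1 *\<^sub>R w x"
          by (intro tendsto_scaleR \<psi>lim tendsto_const) simp
        then show "(\<lambda>n. \<psi> n x *\<^sub>R w x) \<longlonglongrightarrow> w x" by simp
      qed
      show "AE x in meas l. norm (\<psi> n x *\<^sub>R w x) \<le> B" for n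
        using sb by (intro AE_I2) simp
    qed (simp_all add: continuous_on_measurable_meas[OF c\<psi>w] continuous_on_measurable_meas[OF cw']
        continuous_on_integrable_meas)
    also have "(\<integral>x. w x \<partial>(meas l)) = u l - u 0"
    proof (rule integral_meas_FTC)
      show "(u has_vector_derivative w x) (at x within {0..l})" if "x \<in> {0..l}" for x
        using der[OF that] w[OF that] by simp
    qed (use l cw' in auto)
    finally show ?thesis using bc by simp
  qed
  \<comment> \<open>The derivative of the approximating test function, corrected to have mean value zero.\<close>
  define v where "v n x = \<psi> n x *\<^sub>R w x - \<kappa> x *\<^sub>R (s n /\<^sub>R k)" for n x
  have cv: "continuous_on S (v n)" for S n
    unfolding v_def using c\<psi> c\<kappa> continuous_on_subset[OF cw] by (intro continuous_intros) auto
  have "\<exists>\<eta>. \<eta> \<in> test_functions l \<and> (\<forall>x. (\<eta> has_vector_derivative v n x) (at x)) \<and> \<eta> 0 = 0" for n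
  proof -
    define c where "c = min (l / 4) (1 / real (Suc n))"
    have c: "0 < c" "c \<le> l / 4" using l by (auto simp: c_def)
    have cn: "real n * c \<le> 1"
    proof -
      have "real n * c \<le> real n * (1 / real (Suc n))" by (intro mult_left_mono) (auto simp: c_def)
      also have "\<dots> \<le> 1" by (simp add: field_simps)
      finally show ?thesis .
    qed
    have z: "v n x = 0" if "x \<notin> {c..l - c}" for x
    proof -
      have "min x (l - x) \<le> c" using that by auto
      then have "real n * min x (l - x) \<le> 1" using cn mult_left_mono[of "min x (l-x)" c "real n"] by linarith
      then have "\<psi> n x = 0" by (simp add: \<psi>_def)
      moreover have "\<kappa> x = 0" using that c(2) by (auto simp: \<kappa>_def)
      ultimately show ?thesis by (simp add: v_def)
    qed
    have "(\<integral>x. v n x \<partial>(meas l)) = s n - k *\<^sub>R (s n /\<^sub>R k)"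
    proof -
      have "(\<integral>x. \<psi> n x *\<^sub>R w x - \<kappa> x *\<^sub>R e \<partial>(meas l)) = s n - k *\<^sub>R e" for e
        unfolding s_def k_def
        by (subst Bochner_Integration.integral_diff)
           (simp_all add: continuous_on_integrable_meas[OF c\<kappa>] continuous_on_integrable_meas[OF c\<psi>w]
             continuous_on_integrable_meas[OF continuous_on_scaleR[OF c\<kappa> continuous_on_const]])
      then show ?thesis unfolding v_def .
    qed
    also have "\<dots> = 0" using k by simp
    finally have m: "(\<integral>x. v n x \<partial>(meas l)) = 0" .
    show ?thesis
      by (rule test_function_of_derivative[OF cv c(1) _ _ z m]) (use c l in auto)
  qed
  then have "\<forall>n. \<exists>\<eta>. \<eta> \<in> test_functions l \<and> (\<forall>x. (\<eta> has_vector_derivative v n x) (at x)) \<and> \<eta> 0 = 0"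
    by (rule allI)
  from choice[OF this] obtain \<eta> where \<eta>: "\<And>n. \<eta> n \<in> test_functions l"
      "\<And>n x. (\<eta> n has_vector_derivative v n x) (at x)" "\<And>n. \<eta> n 0 = 0"
    by blast
  have vd: "vector_derivative (\<eta> n) (at x) = v n x" for n x
    using \<eta>(2) vector_derivative_at by blast
  obtain S where S: "S > 0" "\<And>n. norm (s n) \<le> S"
    using convergent_imp_Bseq[OF convergentI[OF slim]] unfolding Bseq_def by blast
  define \<delta> where "\<delta> n = (\<integral>x. norm (w x - v n x) \<partial>(meas l))" for n
  have diffb: "norm (w x - v n x) \<le> 2 * B + l * (S / k)" if "x \<in> {0<..<l}" for n x
  proof -
    have "norm (\<kappa> x *\<^sub>R (s n /\<^sub>R k)) \<le> l * (S / k)"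
    proof -
      have "norm (\<kappa> x *\<^sub>R (s n /\<^sub>R k)) = \<kappa> x * (norm (s n) / k)"
        using \<kappa>b(1)[of x] k by (simp add: divide_inverse mult.commute)
      also have "\<dots> \<le> l * (S / k)"
        using \<kappa>b(2)[of x] S(2)[of n] k that l by (intro mult_mono divide_right_mono) auto
      finally show ?thesis .
    qed
    moreover have eq: "w x - v n x = w x - \<psi> n x *\<^sub>R w x + \<kappa> x *\<^sub>R (s n /\<^sub>R k)" by (simp add: v_def)
    have "norm (w x - v n x) \<le> norm (w x) + norm (\<psi> n x *\<^sub>R w x) + norm (\<kappa> x *\<^sub>R (s n /\<^sub>R k))"
      unfolding eq using norm_triangle_ineq[of "w x - \<psi> n x *\<^sub>R w x" "\<kappa> x *\<^sub>R (s n /\<^sub>R k)"]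
        norm_triangle_ineq4[of "w x" "\<psi> n x *\<^sub>R w x"] by linarith
    ultimately show ?thesis using wb[OF that] sb[OF that, of n] by linarith
  qed
  have dlim: "(\<lambda>n. w x - v n x) \<longlonglongrightarrow> 0" if "x \<in> {0<..<l}" for x
  proof -
    have "(\<lambda>n. w x - v n x) \<longlonglongrightarrow> w x - (1 *\<^sub>R w x - \<kappa> x *\<^sub>R (0 /\<^sub>R k))"
      unfolding v_def by (intro tendsto_intros \<psi>lim that slim)
    then show ?thesis by simp
  qed
  have cd: "continuous_on S (\<lambda>x. w x - v n x)" for S n
    using continuous_on_subset[OF cw] by (intro continuous_on_diff cv) auto
  have c1: "continuous_on {0..l} (\<lambda>_. c)" for c :: real by simp
  have \<delta>lim: "\<delta> \<longlonglongrightarrow> 0"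
  proof -
    have "\<delta> \<longlonglongrightarrow> (\<integral>x. (0::real) \<partial>(meas l))"
      unfolding \<delta>_def
    proof (rule integral_dominated_convergence[where w = "\<lambda>_. 2 * B + l * (S / k)"])
      show "AE x in meas l. (\<lambda>n. norm (w x - v n x)) \<longlonglongrightarrow> 0"
        using dlim by (intro AE_I2) (simp add: tendsto_norm_zero_iff)
      show "AE x in meas l. norm (norm (w x - v n x)) \<le> 2 * B + l * (S / k)" for n
        using diffb by (intro AE_I2) simp
      show "(\<lambda>x. norm (w x - v n x)) \<in> borel_measurable (meas l)" for n
        by (rule continuous_on_measurable_meas[OF continuous_on_norm[OF cd]])
    qed (simp_all add: continuous_on_integrable_meas[OF c1])
    then show ?thesis by simp
  qed
  have wL: "w \<in> L2 l" by (rule continuous_in_L2[OF cw'])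
  show ?thesis
  proof (rule H1_0_I[OF continuous_in_L2[OF cu] wL _ \<eta>(1)])
    show "weak_deriv l u w"
      by (rule weak_deriv_classical[OF l _ cw']) (use der w in simp)
    have le: "norm (u x - \<eta> n x) \<le> \<delta> n" if "x \<in> {0<..<l}" for n x
    proof -
      have sub: "{0..x} \<subseteq> {0..l}" using that by auto
      have "(\<integral>y. w y - v n y \<partial>(meas x)) = (u x - \<eta> n x) - (u 0 - \<eta> n 0)"
      proof (rule integral_meas_FTC)
        show "((\<lambda>x. u x - \<eta> n x) has_vector_derivative w y - v n y) (at y within {0..x})"
          if "y \<in> {0..x}" for y
        proof (rule has_vector_derivative_diff)
          have "y \<in> {0..l}" using that sub by blast
          then show "(u has_vector_derivative w y) (at y within {0..x})"
            using has_vector_derivative_within_subset[OF der sub] w by simp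
          show "(\<eta> n has_vector_derivative v n y) (at y within {0..x})"
            by (rule has_vector_derivative_at_within[OF \<eta>(2)])
        qed
      qed (use that cd in auto)
      then have "norm (u x - \<eta> n x) = norm (\<integral>y. w y - v n y \<partial>(meas x))" using bc \<eta>(3) by simp
      also have "\<dots> \<le> (\<integral>y. norm (w y - v n y) \<partial>(meas x))" by (rule integral_norm_bound)
      also have "\<dots> \<le> \<delta> n" unfolding \<delta>_def
        by (rule integral_mono_lebesgue_on_AE)
           (use that in \<open>auto intro!: continuous_on_integrable_meas continuous_on_norm cd\<close>)
      finally show ?thesis .
    qed
    have \<delta>0: "\<delta> n \<ge> 0" for n unfolding \<delta>_def by simp
    show "(\<lambda>n. L2_norm l (\<lambda>x. u x - \<eta> n x)) \<longlonglongrightarrow> 0"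
    proof (rule real_tendsto_sandwich[OF _ _ tendsto_const])
      show "(\<lambda>n. sqrt l * \<delta> n) \<longlonglongrightarrow> 0" using \<delta>lim by (auto intro!: tendsto_eq_intros)
      show "\<forall>\<^sub>F n in sequentially. L2_norm l (\<lambda>x. u x - \<eta> n x) \<le> sqrt l * \<delta> n"
        by (rule always_eventually, rule allI,
            rule L2_norm_le_bound[OF L2_diff[OF continuous_in_L2[OF cu] test_function_L2(1)[OF \<eta>(1) l]] le l \<delta>0])
    qed (simp add: L2_norm_nonneg)
    have "(\<lambda>n. ip l (\<lambda>x. w x - v n x) (\<lambda>x. w x - v n x)) \<longlonglongrightarrow> (\<integral>x. (0::real) \<partial>(meas l))"
      unfolding ip_def
    proof (rule integral_dominated_convergence[where w = "\<lambda>_. (2 * B + l * (S / k))\<^sup>2"])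
      show "AE x in meas l. (\<lambda>n. (w x - v n x) \<bullet> (w x - v n x)) \<longlonglongrightarrow> 0"
      proof (rule AE_I2)
        fix x assume "x \<in> space (meas l)"
        then have "(\<lambda>n. (w x - v n x) \<bullet> (w x - v n x)) \<longlonglongrightarrow> 0 \<bullet> (0::complex)"
          by (intro tendsto_inner dlim) auto
        then show "(\<lambda>n. (w x - v n x) \<bullet> (w x - v n x)) \<longlonglongrightarrow> 0" by simp
      qed
      show "AE x in meas l. norm ((w x - v n x) \<bullet> (w x - v n x)) \<le> (2 * B + l * (S / k))\<^sup>2" for n
        using diffb by (intro AE_I2) (simp add: dot_square_norm power_mono)
      show "(\<lambda>x. (w x - v n x) \<bullet> (w x - v n x)) \<in> borel_measurable (meas l)" for n
        by (rule continuous_on_measurable_meas[OF continuous_on_inner[OF cd cd]])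
    qed (simp_all add: continuous_on_integrable_meas[OF c1])
    then have "(\<lambda>n. sqrt ((L2_norm l (\<lambda>x. w x - v n x))\<^sup>2)) \<longlonglongrightarrow> sqrt 0"
      unfolding L2_norm_sq by (intro tendsto_intros) simp
    then show "(\<lambda>n. L2_norm l (\<lambda>x. w x - vector_derivative (\<eta> n) (at x))) \<longlonglongrightarrow> 0"
      by (simp add: vd L2_norm_nonneg)
  qed
qed

text \<open>
  Differentiability is relative to the closed interval, hence one-sided at the end points; this
  covers the functions built from solutions of the profile equation.
\<close>

lemma dirichlet_classical:
  fixes u u1 u2 q :: "real \<Rightarrow> real"
  assumes l: "l > 0"
    and d1: "\<And>x. x \<in> {0..l} \<Longrightarrow> (u has_vector_derivative u1 x) (at x within {0..l})"
    and d2: "\<And>x. x \<in> {0..l} \<Longrightarrow> (u1 has_vector_derivative u2 x) (at x within {0..l})"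
    and cont: "continuous_on {0..l} u2" and q: "continuous_on {0..l} q" and bc: "u 0 = 0" "u l = 0"
  shows "(\<lambda>x. complex_of_real (u x), \<lambda>x. complex_of_real (- u2 x - q x * u x)) \<in> dirichlet_op l q"
proof -
  let ?c = "complex_of_real"
  have c: "continuous_on {0..l} u" "continuous_on {0..l} u1"
    using d1 d2 by (meson continuous_on_eq_continuous_within has_vector_derivative_continuous)+
  have D1: "((\<lambda>x. ?c (u x)) has_vector_derivative ?c (u1 x)) (at x within {0..l})" if "x \<in> {0..l}" for x
    by (rule bounded_linear.has_vector_derivative[OF bounded_linear_of_real d1[OF that]])
  have D2: "((\<lambda>x. ?c (u1 x)) has_vector_derivative ?c (u2 x)) (at x within {0..l})" if "x \<in> {0..l}" for x
    by (rule bounded_linear.has_vector_derivative[OF bounded_linear_of_real d2[OF that]])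
  have C1: "continuous_on {0..l} (\<lambda>x. ?c (u1 x))" by (intro continuous_intros c)
  have C2: "continuous_on {0..l} (\<lambda>x. ?c (u2 x))" by (intro continuous_intros cont)
  have C3: "continuous_on {0..l} (\<lambda>x. ?c (- u2 x - q x * u x))" by (intro continuous_intros cont q c)
  have C0: "continuous_on {0..l} (\<lambda>x. ?c (u x))" by (intro continuous_intros c)
  show ?thesis
  proof (rule dirichlet_op_I)
    show "(\<lambda>x. ?c (u x)) \<in> L2 l" "(\<lambda>x. ?c (u1 x)) \<in> L2 l" "(\<lambda>x. ?c (u2 x)) \<in> L2 l"
      "(\<lambda>x. ?c (- u2 x - q x * u x)) \<in> L2 l"
      by (rule continuous_in_L2[OF C0] continuous_in_L2[OF C1] continuous_in_L2[OF C2] continuous_in_L2[OF C3])+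
    show "weak_deriv l (\<lambda>x. ?c (u x)) (\<lambda>x. ?c (u1 x))" by (rule weak_deriv_classical[OF l D1 C1])
    show "weak_deriv l (\<lambda>x. ?c (u1 x)) (\<lambda>x. ?c (u2 x))" by (rule weak_deriv_classical[OF l D2 C2])
    show "(\<lambda>x. ?c (u x)) \<in> H1_0 l" by (rule H1_0_classical[OF l D1 C1]) (use bc in auto)
  qed simp
qed

section \<open>Positivity from a zero-free solution\<close>

lemma L2_norm_mult_continuous:
  assumes "continuous_on {0..l} q"
  obtains B where "B > 0"
    "\<And>u :: real \<Rightarrow> complex. u \<in> L2 l \<Longrightarrow> L2_norm l (\<lambda>x. of_real (q x) * u x) \<le> B * L2_norm l u"
proof -
  obtain B where B: "B > 0" "\<And>x. x \<in> {0..l} \<Longrightarrow> norm (q x) \<le> B"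
    using continuous_on_interval_bound[OF assms] by blast
  have "L2_norm l (\<lambda>x. of_real (q x) * u x) \<le> B * L2_norm l u" if u: "u \<in> L2 l" for u :: "real \<Rightarrow> complex"
  proof -
    have "(\<integral>x. (norm (of_real (q x) * u x))\<^sup>2 \<partial>(meas l)) \<le> (\<integral>x. B\<^sup>2 * (norm (u x))\<^sup>2 \<partial>(meas l))"
    proof (rule integral_mono)
      show "integrable (meas l) (\<lambda>x. (norm (of_real (q x) * u x))\<^sup>2)"
        by (rule L2_D(2)[OF L2_mult_continuous[OF u assms]])
      show "integrable (meas l) (\<lambda>x. B\<^sup>2 * (norm (u x))\<^sup>2)"
        by (intro integrable_mult_right L2_D(2)[OF u])
      fix x assume "x \<in> space (meas l)"
      then have "norm (q x) \<le> B" using B(2) by simp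
      then have "(norm (q x))\<^sup>2 \<le> B\<^sup>2" by (rule power_mono) simp
      then show "(norm (of_real (q x) * u x))\<^sup>2 \<le> B\<^sup>2 * (norm (u x))\<^sup>2"
        by (simp add: norm_mult power_mult_distrib mult_right_mono)
    qed
    also have "\<dots> = B\<^sup>2 * (\<integral>x. (norm (u x))\<^sup>2 \<partial>(meas l))" by simp
    finally have "L2_norm l (\<lambda>x. of_real (q x) * u x) \<le> sqrt (B\<^sup>2 * (\<integral>x. (norm (u x))\<^sup>2 \<partial>(meas l)))"
      unfolding L2_norm_def by (rule real_sqrt_le_mono)
    then show ?thesis using B(1) by (simp add: real_sqrt_mult L2_norm_def)
  qed
  then show ?thesis using that B(1) by blast
qed

text \<open>
  Jacobi's factorization. If \<open>\<phi>\<close> has no zeros and \<open>\<phi>'' = - h \<phi>\<close>, then \<open>r = \<phi>' / \<phi>\<close> solves the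
  Riccati equation \<open>r' = - h - r\<^sup>2\<close>, and \<open>|\<eta>'|\<^sup>2 - h |\<eta>|\<^sup>2\<close> is the sum of \<open>|\<eta>' - r \<eta>|\<^sup>2\<close> and of the
  derivative of \<open>r |\<eta>|\<^sup>2\<close>, which integrates to zero.
\<close>

lemma energy_nonneg_test_function:
  assumes l: "l > 0" and \<eta>: "\<eta> \<in> test_functions l"
    and d1: "\<And>x. x \<in> {0..l} \<Longrightarrow> (\<phi> has_vector_derivative \<phi>1 x) (at x within {0..l})"
    and d2: "\<And>x. x \<in> {0..l} \<Longrightarrow> (\<phi>1 has_vector_derivative - (h x * \<phi> x)) (at x within {0..l})"
    and pos: "\<And>x. x \<in> {0..l} \<Longrightarrow> \<phi> x \<noteq> (0::real)" and h: "continuous_on {0..l} h"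
  shows "ip l (\<lambda>x. of_real (h x) * \<eta> x) \<eta>
    \<le> ip l (\<lambda>x. vector_derivative \<eta> (at x)) (\<lambda>x. vector_derivative \<eta> (at x))"
proof -
  obtain \<eta>' c d where d: "0 < c" "d < l" "\<And>x. (\<eta> has_vector_derivative \<eta>' x) (at x)"
    "continuous_on UNIV \<eta>'" "\<And>x. vector_derivative \<eta> (at x) = \<eta>' x" "\<And>x. x \<notin> {c..d} \<Longrightarrow> \<eta> x = 0"
    using test_functionE[OF \<eta> l] by metis
  define r where "r x = \<phi>1 x / \<phi> x" for x
  have c0: "continuous_on {0..l} \<phi>" "continuous_on {0..l} \<phi>1"
    using d1 d2 by (meson continuous_on_eq_continuous_within has_vector_derivative_continuous)+
  have cr: "continuous_on {0..l} r" unfolding r_def using pos by (intro continuous_on_divide c0) auto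
  have c\<eta>: "continuous_on {0..l} \<eta>"
    using d(3) by (meson continuous_at_imp_continuous_on has_vector_derivative_continuous)
  have c\<eta>': "continuous_on {0..l} \<eta>'" by (rule continuous_on_subset[OF d(4)]) simp
  define G where "G x = (norm (\<eta>' x - r x *\<^sub>R \<eta> x))\<^sup>2" for x
  have cG: "continuous_on {0..l} G" unfolding G_def by (intro continuous_intros c\<eta>' cr c\<eta>)
  define H where "H x = \<eta>' x \<bullet> \<eta>' x - h x * (\<eta> x \<bullet> \<eta> x)" for x
  have cH: "continuous_on {0..l} H" unfolding H_def by (intro continuous_intros c\<eta>' h c\<eta>)
  have "(\<integral>x. H x - G x \<partial>(meas l)) = r l * (\<eta> l \<bullet> \<eta> l) - r 0 * (\<eta> 0 \<bullet> \<eta> 0)"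
  proof (rule integral_meas_FTC)
    fix x assume x: "x \<in> {0..l}"
    have f1: "(\<phi> has_real_derivative \<phi>1 x) (at x within {0..l})"
      "(\<phi>1 has_real_derivative - (h x * \<phi> x)) (at x within {0..l})"
      using d1[OF x] d2[OF x] by (simp_all add: has_real_derivative_iff_has_vector_derivative)
    have "(r has_real_derivative (- (h x * \<phi> x) * \<phi> x - \<phi>1 x * \<phi>1 x) / (\<phi> x * \<phi> x)) (at x within {0..l})"
      unfolding r_def by (rule DERIV_divide[OF f1(2,1) pos[OF x]])
    moreover have "(- (h x * \<phi> x) * \<phi> x - \<phi>1 x * \<phi>1 x) / (\<phi> x * \<phi> x) = - h x - r x * r x"
      using pos[OF x] by (simp add: r_def field_simps)
    ultimately have dr: "(r has_vector_derivative - h x - r x * r x) (at x within {0..l})"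
      by (simp add: has_real_derivative_iff_has_vector_derivative)
    have de: "((\<lambda>x. \<eta> x \<bullet> \<eta> x) has_vector_derivative \<eta> x \<bullet> \<eta>' x + \<eta>' x \<bullet> \<eta> x) (at x within {0..l})"
      by (rule bounded_bilinear.has_vector_derivative[OF bounded_bilinear_inner];
          rule has_vector_derivative_at_within[OF d(3)])
    have "((\<lambda>x. r x * (\<eta> x \<bullet> \<eta> x)) has_vector_derivative
        r x * (\<eta> x \<bullet> \<eta>' x + \<eta>' x \<bullet> \<eta> x) + (- h x - r x * r x) * (\<eta> x \<bullet> \<eta> x)) (at x within {0..l})"
      by (rule has_vector_derivative_mult[OF dr de])
    moreover have "r x * (\<eta> x \<bullet> \<eta>' x + \<eta>' x \<bullet> \<eta> x) + (- h x - r x * r x) * (\<eta> x \<bullet> \<eta> x) = H x - G x"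
      unfolding G_def H_def power2_norm_eq_inner
      by (simp add: inner_diff_left inner_diff_right inner_commute[of "\<eta>' x" "\<eta> x"] algebra_simps)
    ultimately show "((\<lambda>x. r x * (\<eta> x \<bullet> \<eta> x)) has_vector_derivative H x - G x) (at x within {0..l})"
      by simp
  qed (use l in \<open>auto intro!: continuous_on_diff cG cH\<close>)
  also have "\<dots> = 0" using d(1,2) d(6)[of 0] d(6)[of l] by simp
  finally have "(\<integral>x. H x \<partial>(meas l)) = (\<integral>x. G x \<partial>(meas l))"
    using continuous_on_integrable_meas[OF cG] continuous_on_integrable_meas[OF cH] by simp
  also have "\<dots> \<ge> 0" unfolding G_def by (rule integral_nonneg_AE) simp
  finally have "0 \<le> (\<integral>x. \<eta>' x \<bullet> \<eta>' x \<partial>(meas l)) - (\<integral>x. h x * (\<eta> x \<bullet> \<eta> x) \<partial>(meas l))"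
    unfolding H_def
    using continuous_on_integrable_meas[OF continuous_on_inner[OF c\<eta>' c\<eta>']]
      continuous_on_integrable_meas[OF continuous_on_mult[OF h continuous_on_inner[OF c\<eta> c\<eta>]]] by simp
  then show ?thesis
    unfolding ip_def d(5) scaleR_conv_of_real[symmetric] inner_scaleR_left by simp
qed

text \<open>
  The factorization passes from test functions to the whole domain by density in the norm of $H^1$.
\<close>

lemma dirichlet_op_nonneg:
  assumes l: "l > 0" and wa: "(w, a) \<in> dirichlet_op l h"
    and d1: "\<And>x. x \<in> {0..l} \<Longrightarrow> (\<phi> has_vector_derivative \<phi>1 x) (at x within {0..l})"
    and d2: "\<And>x. x \<in> {0..l} \<Longrightarrow> (\<phi>1 has_vector_derivative - (h x * \<phi> x)) (at x within {0..l})"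
    and pos: "\<And>x. x \<in> {0..l} \<Longrightarrow> \<phi> x \<noteq> (0::real)" and h: "continuous_on {0..l} h"
  shows "ip l a w \<ge> 0"
proof -
  note w = dirichlet_op_L2(3)[OF wa]
  note gw = grad(1-3)[OF w]
  obtain \<eta> where \<eta>: "\<And>n::nat. \<eta> n \<in> test_functions l"
      "(\<lambda>n. L2_norm l (\<lambda>x. w x - \<eta> n x)) \<longlonglongrightarrow> 0"
      "(\<lambda>n. L2_norm l (\<lambda>x. grad l w x - vector_derivative (\<eta> n) (at x))) \<longlonglongrightarrow> 0"
    using grad_approx[OF w] by blast
  note \<eta>L = test_function_L2[OF \<eta>(1) l]
  obtain B where B: "B > 0"
    "\<And>u :: real \<Rightarrow> complex. u \<in> L2 l \<Longrightarrow> L2_norm l (\<lambda>x. of_real (h x) * u x) \<le> B * L2_norm l u"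
    using L2_norm_mult_continuous[OF h] by blast
  have hlim: "(\<lambda>n. L2_norm l (\<lambda>x. of_real (h x) * w x - of_real (h x) * \<eta> n x)) \<longlonglongrightarrow> 0"
  proof (rule real_tendsto_sandwich[OF _ _ tendsto_const])
    show "(\<lambda>n. B * L2_norm l (\<lambda>x. w x - \<eta> n x)) \<longlonglongrightarrow> 0"
      using tendsto_mult_right_zero[OF \<eta>(2)] .
    show "\<forall>\<^sub>F n in sequentially. L2_norm l (\<lambda>x. of_real (h x) * w x - of_real (h x) * \<eta> n x)
        \<le> B * L2_norm l (\<lambda>x. w x - \<eta> n x)"
      unfolding right_diff_distrib[symmetric]
      by (rule always_eventually, rule allI, rule B(2)[OF L2_diff[OF gw(1) \<eta>L(1)]])
  qed (simp add: L2_norm_nonneg)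
  have "ip l (\<lambda>x. of_real (h x) * w x) w \<le> ip l (grad l w) (grad l w)"
  proof (rule LIMSEQ_le)
    show "(\<lambda>n. ip l (\<lambda>x. of_real (h x) * \<eta> n x) (\<eta> n)) \<longlonglongrightarrow> ip l (\<lambda>x. of_real (h x) * w x) w"
      by (rule ip_tendsto[OF L2_mult_continuous[OF gw(1) h] gw(1) L2_mult_continuous[OF \<eta>L(1) h] \<eta>L(1) hlim \<eta>(2)])
    show "(\<lambda>n. ip l (\<lambda>x. vector_derivative (\<eta> n) (at x)) (\<lambda>x. vector_derivative (\<eta> n) (at x)))
        \<longlonglongrightarrow> ip l (grad l w) (grad l w)"
      by (rule ip_tendsto[OF gw(2) gw(2) \<eta>L(2) \<eta>L(2) \<eta>(3) \<eta>(3)])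
    show "\<exists>N. \<forall>n\<ge>N. ip l (\<lambda>x. of_real (h x) * \<eta> n x) (\<eta> n)
        \<le> ip l (\<lambda>x. vector_derivative (\<eta> n) (at x)) (\<lambda>x. vector_derivative (\<eta> n) (at x))"
      using energy_nonneg_test_function[OF l \<eta>(1) d1 d2 pos h] by blast
  qed
  then show ?thesis using dirichlet_form[OF wa w h l] by simp
qed

section \<open>A negative direction from a solution with an interior zero\<close>

text \<open>
  A Gronwall argument: the derivative of \<open>E = a\<^sup>2 + b\<^sup>2\<close> is at most a multiple of \<open>E\<close> in absolute
  value. Hence \<open>E\<close> times a decaying exponential is nonincreasing and \<open>E\<close> times a growing one is
  nondecreasing, so that a zero of \<open>E\<close> spreads to the right and to the left.
\<close>

lemma second_order_ode_unique_zero: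
  fixes a b g :: "real \<Rightarrow> real"
  assumes d1: "\<And>x. x \<in> {0..l} \<Longrightarrow> (a has_vector_derivative b x) (at x within {0..l})"
    and d2: "\<And>x. x \<in> {0..l} \<Longrightarrow> (b has_vector_derivative - (g x * a x)) (at x within {0..l})"
    and g: "continuous_on {0..l} g" and x0: "x0 \<in> {0..l}" "a x0 = 0" "b x0 = 0" and y: "y \<in> {0..l}"
  shows "a y = 0"
proof -
  obtain K where K: "K > 0" "\<And>x. x \<in> {0..l} \<Longrightarrow> norm (g x) \<le> K"
    using continuous_on_interval_bound[OF g] by blast
  define E where "E x = (a x)\<^sup>2 + (b x)\<^sup>2" for x
  define E' where "E' x = 2 * (a x * b x) * (1 - g x)" for x
  have E'b: "\<bar>E' x\<bar> \<le> (1 + K) * E x" if "x \<in> {0..l}" for x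
  proof -
    have 1: "\<bar>2 * (a x * b x)\<bar> \<le> E x"
      using sum_squares_bound[of "a x" "b x"] sum_squares_bound[of "a x" "- b x"]
      unfolding E_def by (simp add: abs_le_iff)
    have 2: "\<bar>1 - g x\<bar> \<le> 1 + K" using K(2)[OF that] by (simp add: abs_le_iff)
    have "\<bar>2 * (a x * b x)\<bar> * \<bar>1 - g x\<bar> \<le> E x * (1 + K)"
      by (rule mult_mono[OF 1 2]) (auto simp: E_def)
    then show ?thesis by (simp add: E'_def abs_mult mult.commute)
  qed
  have dE: "(E has_real_derivative E' x) (at x within {0..l})" if "x \<in> {0..l}" for x
  proof -
    have f: "(a has_real_derivative b x) (at x within {0..l})"
      "(b has_real_derivative - (g x * a x)) (at x within {0..l})"
      using d1[OF that] d2[OF that] by (simp_all add: has_real_derivative_iff_has_vector_derivative)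
    show ?thesis unfolding E_def E'_def
      by (rule derivative_eq_intros f refl)+ (simp add: algebra_simps)
  qed
  have step: "\<exists>z\<in>{r..s}. E s * exp (c * s) - E r * exp (c * r) = ((E' z + c * E z) * exp (c * z)) * (s - r)"
    if "r \<le> s" "{r..s} \<subseteq> {0..l}" for r s c
  proof -
    have "\<exists>z\<in>{r..s}. E s * exp (c * s) - E r * exp (c * r)
        = (\<lambda>t. ((E' z + c * E z) * exp (c * z)) * t) (s - r)"
    proof (rule mvt_very_simple[OF that(1)])
      fix x assume "r \<le> x" "x \<le> s"
      then have x: "x \<in> {0..l}" using that(2) by auto
      have "((\<lambda>x. E x * exp (c * x)) has_real_derivative (E' x + c * E x) * exp (c * x)) (at x within {0..l})"
        by (rule derivative_eq_intros dE[OF x] refl)+ (simp add: algebra_simps)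
      then have "((\<lambda>x. E x * exp (c * x)) has_real_derivative (E' x + c * E x) * exp (c * x)) (at x within {r..s})"
        by (rule has_field_derivative_subset[OF _ that(2)])
      then show "((\<lambda>x. E x * exp (c * x)) has_derivative (\<lambda>t. ((E' x + c * E x) * exp (c * x)) * t)) (at x within {r..s})"
        by (simp add: has_field_derivative_def)
    qed
    then show ?thesis by simp
  qed
  define M where "M = 1 + K"
  have b: "\<bar>E' z\<bar> \<le> M * E z" if "z \<in> {0..l}" for z using E'b[OF that] by (simp add: M_def)
  have E0: "E x0 = 0" using x0 by (simp add: E_def)
  have "E y \<le> 0"
  proof (cases "x0 \<le> y")
    case True
    have sub: "{x0..y} \<subseteq> {0..l}" using x0(1) y by auto
    obtain z where z: "z \<in> {x0..y}" "E y * exp (- M * y) - E x0 * exp (- M * x0) =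
        ((E' z + - M * E z) * exp (- M * z)) * (y - x0)"
      using step[OF True sub, of "- M"] by blast
    have "E' z + - M * E z \<le> 0" using b[of z] z(1) sub by (auto simp: abs_le_iff)
    then have "((E' z + - M * E z) * exp (- M * z)) * (y - x0) \<le> 0"
      using True by (intro mult_nonpos_nonneg) auto
    then have "E y * exp (- M * y) \<le> 0" using z(2) E0 by simp
    then show ?thesis by (simp add: mult_le_0_iff)
  next
    case False
    then have le: "y \<le> x0" by simp
    have sub: "{y..x0} \<subseteq> {0..l}" using x0(1) y by auto
    obtain z where z: "z \<in> {y..x0}" "E x0 * exp (M * x0) - E y * exp (M * y) =
        ((E' z + M * E z) * exp (M * z)) * (x0 - y)"
      using step[OF le sub, of M] by blast
    have "E' z + M * E z \<ge> 0" using b[of z] z(1) sub by (auto simp: abs_le_iff)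
    then have "((E' z + M * E z) * exp (M * z)) * (x0 - y) \<ge> 0"
      using le by (intro mult_nonneg_nonneg) auto
    then have "E y * exp (M * y) \<le> 0" using z(2) E0 by simp
    then show ?thesis by (simp add: mult_le_0_iff)
  qed
  then have "(a y)\<^sup>2 \<le> 0" unfolding E_def using zero_le_power2[of "b y"] by linarith
  then show ?thesis by simp
qed

lemma integral_meas_cut:
  fixes f :: "real \<Rightarrow> real"
  assumes "m \<le> l"
  shows "(\<integral>x. (if x < m then f x else 0) \<partial>(meas l)) = (\<integral>x. f x \<partial>(meas m))"
proof -
  have "{..<m} \<inter> {0<..<l} = {0<..<m}" using assms by auto
  then show ?thesis
    using Lebesgue_Measure.integral_restrict_Int[of "{..<m}" "{0<..<l}" f] by simp
qed

text \<open>
  A function that vanishes together with its derivative at the cutting point stays differentiable,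
  also there, when it is continued by zero.
\<close>

lemma has_vector_derivative_cut:
  fixes p :: "real \<Rightarrow> real"
  assumes d: "\<And>x. x \<in> {0..m} \<Longrightarrow> (p has_vector_derivative p' x) (at x within {0..m})"
    and z: "p m = 0" "p' m = 0" and m: "0 < m" "m \<le> l" and x: "x \<in> {0..l}"
  shows "((\<lambda>x. if x < m then p x else 0) has_vector_derivative (if x < m then p' x else 0)) (at x within {0..l})"
proof -
  have cl: "closure {0..<m} = {0..m}" using m closure_atLeastLessThan[of 0 m] by simp
  have "((\<lambda>x. if x \<in> {0..<m} then p x else 0) has_vector_derivative (if x \<in> {0..<m} then p' x else 0)) (at x within {0..l})"
  proof (rule has_vector_derivative_If_within_closures[where T = "{m..l}"])
    show "x \<in> {0..<m} \<union> {m..l}" "{0..l} = {0..<m} \<union> {m..l}" using x m by auto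
    have eq: "{0..<m} \<union> closure {0..<m} \<inter> closure {m..l} = {0..m}"
      unfolding cl using m by auto
    show "(p has_vector_derivative p' x) (at x within {0..<m} \<union> closure {0..<m} \<inter> closure {m..l})"
      if "x \<in> {0..<m} \<union> closure {0..<m} \<inter> closure {m..l}"
      using d[of x] that unfolding eq by blast
    show "((\<lambda>x. 0) has_vector_derivative 0) (at x within {m..l} \<union> closure {0..<m} \<inter> closure {m..l})" by simp
    show "p x = 0" if "x \<in> closure {0..<m}" "x \<in> closure {m..l}"
    proof -
      have "x = m" using that unfolding cl by auto
      then show ?thesis using z by simp
    qed
    show "p' x = 0" if "x \<in> closure {0..<m}" "x \<in> closure {m..l}"
    proof -
      have "x = m" using that unfolding cl by auto
      then show ?thesis using z by simp
    qed
  qed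
  moreover have "(if x \<in> {0..<m} then p' x else 0) = (if x < m then p' x else 0)" using x by auto
  ultimately have "((\<lambda>x. if x \<in> {0..<m} then p x else 0) has_vector_derivative (if x < m then p' x else 0)) (at x within {0..l})"
    by (simp only:)
  then show ?thesis by (rule has_vector_derivative_transform[OF x, rotated]) auto
qed

lemma ip_of_real:
  "ip l (\<lambda>x. complex_of_real (u x)) (\<lambda>x. complex_of_real (v x)) = (\<integral>x. u x * v x \<partial>(meas l))"
  by (simp add: ip_def inner_complex_def)

text \<open>
  The map \<open>y \<mapsto> y - \<delta> arctan (y / \<delta>)\<close> is close to the identity, has derivative in \<open>[0,1)\<close> and vanishes
  at 0 together with its first two derivatives. Composed with a function that has a simple zero, it
  can therefore be cut off at that zero and stays twice continuously differentiable, while the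
  integral of its squared derivative does not increase.
\<close>

lemma DERIV_shrink:
  fixes \<delta> y :: real
  assumes "\<delta> > 0"
  shows "((\<lambda>y. y - \<delta> * arctan (y / \<delta>)) has_real_derivative y\<^sup>2 / (y\<^sup>2 + \<delta>\<^sup>2)) (at y)"
    and "((\<lambda>y. y\<^sup>2 / (y\<^sup>2 + \<delta>\<^sup>2)) has_real_derivative 2 * y * \<delta>\<^sup>2 / (y\<^sup>2 + \<delta>\<^sup>2)\<^sup>2) (at y)"
proof -
  have p: "y\<^sup>2 + \<delta>\<^sup>2 > 0" using assms by (simp add: add_nonneg_pos)
  have eq: "1 - \<delta> * (1 / \<delta> * inverse (1 + (y / \<delta>)\<^sup>2)) = y\<^sup>2 / (y\<^sup>2 + \<delta>\<^sup>2)"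
  proof -
    have "1 + (y / \<delta>)\<^sup>2 = (y\<^sup>2 + \<delta>\<^sup>2) / \<delta>\<^sup>2" using assms by (simp add: field_simps)
    then have "1 - \<delta> * (1 / \<delta> * inverse (1 + (y / \<delta>)\<^sup>2)) = 1 - \<delta>\<^sup>2 / (y\<^sup>2 + \<delta>\<^sup>2)"
      using assms by simp
    also have "\<dots> = ((y\<^sup>2 + \<delta>\<^sup>2) - \<delta>\<^sup>2) / (y\<^sup>2 + \<delta>\<^sup>2)"
      using assms by (simp only: diff_divide_distrib) auto
    finally show ?thesis by simp
  qed
  have d: "((\<lambda>y. y - \<delta> * arctan (y / \<delta>)) has_real_derivative
      1 - \<delta> * (1 / \<delta> * inverse (1 + (y / \<delta>)\<^sup>2))) (at y)"
  proof -
    have "((\<lambda>y. y / \<delta>) has_real_derivative 1 / \<delta>) (at y)"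
      by (rule DERIV_cdivide[OF DERIV_ident])
    from DERIV_chain2[OF DERIV_arctan this]
    have "((\<lambda>y. arctan (y / \<delta>)) has_real_derivative inverse (1 + (y / \<delta>)\<^sup>2) * (1 / \<delta>)) (at y)" .
    from DERIV_diff[OF DERIV_ident DERIV_cmult[OF this]] show ?thesis
      by (simp only: mult.commute[of "inverse (1 + (y / \<delta>)\<^sup>2)"])
  qed
  show "((\<lambda>y. y - \<delta> * arctan (y / \<delta>)) has_real_derivative y\<^sup>2 / (y\<^sup>2 + \<delta>\<^sup>2)) (at y)"
    by (rule DERIV_cong[OF d eq])
  show "((\<lambda>y. y\<^sup>2 / (y\<^sup>2 + \<delta>\<^sup>2)) has_real_derivative 2 * y * \<delta>\<^sup>2 / (y\<^sup>2 + \<delta>\<^sup>2)\<^sup>2) (at y)"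
  proof -
    have n: "y\<^sup>2 + \<delta>\<^sup>2 \<noteq> 0" using p by linarith
    have s: "((\<lambda>y. y\<^sup>2) has_real_derivative 2 * y) (at y)"
      using DERIV_power[OF DERIV_ident, of 2] by simp
    have "((\<lambda>y. y\<^sup>2 + \<delta>\<^sup>2) has_real_derivative 2 * y) (at y)"
      using DERIV_add[OF s DERIV_const] by simp
    from DERIV_divide[OF s this n]
    have "((\<lambda>y. y\<^sup>2 / (y\<^sup>2 + \<delta>\<^sup>2)) has_real_derivative
        (2 * y * (y\<^sup>2 + \<delta>\<^sup>2) - y\<^sup>2 * (2 * y)) / ((y\<^sup>2 + \<delta>\<^sup>2) * (y\<^sup>2 + \<delta>\<^sup>2))) (at y)" .
    moreover have "2 * y * (y\<^sup>2 + \<delta>\<^sup>2) - y\<^sup>2 * (2 * y) = 2 * y * \<delta>\<^sup>2"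
      by (simp add: algebra_simps)
    ultimately show ?thesis by (simp only: power2_eq_square[of "y\<^sup>2 + \<delta>\<^sup>2"])
  qed
qed

lemma dirichlet_energy_classical:
  fixes g p p1 p2 :: "real \<Rightarrow> real"
  assumes m: "m > 0"
    and d1: "\<And>x. x \<in> {0..m} \<Longrightarrow> (p has_vector_derivative p1 x) (at x within {0..m})"
    and d2: "\<And>x. x \<in> {0..m} \<Longrightarrow> (p1 has_vector_derivative p2 x) (at x within {0..m})"
    and c: "continuous_on {0..m} p2" "continuous_on {0..m} g" and z: "p 0 = 0" "p m = 0"
  shows "(\<integral>x. (- p2 x - g x * p x) * p x \<partial>(meas m)) = (\<integral>x. (p1 x)\<^sup>2 - g x * (p x)\<^sup>2 \<partial>(meas m))"
proof -
  have cp: "continuous_on {0..m} p" "continuous_on {0..m} p1"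
    using d1 d2 by (meson continuous_on_eq_continuous_within has_vector_derivative_continuous)+
  let ?A = "\<lambda>x. (- p2 x - g x * p x) * p x" and ?B = "\<lambda>x. (p1 x)\<^sup>2 - g x * (p x)\<^sup>2"
  have cA: "continuous_on {0..m} ?A" "continuous_on {0..m} ?B" by (intro continuous_intros cp c)+
  have "(\<integral>x. ?B x - ?A x \<partial>(meas m)) = p m * p1 m - p 0 * p1 0"
  proof (rule integral_meas_FTC)
    fix x assume x: "x \<in> {0..m}"
    have "((\<lambda>x. p x * p1 x) has_vector_derivative p x * p2 x + p1 x * p1 x) (at x within {0..m})"
      by (rule has_vector_derivative_mult[OF d1[OF x] d2[OF x]])
    moreover have "p x * p2 x + p1 x * p1 x = ?B x - ?A x" by (simp add: power2_eq_square algebra_simps)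
    ultimately show "((\<lambda>x. p x * p1 x) has_vector_derivative ?B x - ?A x) (at x within {0..m})" by simp
  qed (use m in \<open>auto intro!: continuous_on_diff[OF cA(2,1)]\<close>)
  then show ?thesis
    using z continuous_on_integrable_meas[OF cA(1)] continuous_on_integrable_meas[OF cA(2)] by simp
qed

lemma shrink_near_identity: 
  fixes \<delta> y :: real
  assumes "\<delta> > 0"
  shows "\<bar>(y - \<delta> * arctan (y / \<delta>)) - y\<bar> \<le> 2 * \<delta>"
proof -
  have "\<bar>arctan (y / \<delta>)\<bar> \<le> pi / 2" using arctan_lbound[of "y / \<delta>"] arctan_ubound[of "y / \<delta>"] by linarith
  then have "\<bar>arctan (y / \<delta>)\<bar> \<le> 2" using pi_less_4 by linarith
  then have "\<delta> * \<bar>arctan (y / \<delta>)\<bar> \<le> \<delta> * 2" using assms by (intro mult_left_mono) auto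
  then show ?thesis using assms by (simp add: abs_mult mult.commute)
qed

text \<open>
  Let \<open>a0\<close> be \<open>a\<close> on \<open>[0,m]\<close> and zero beyond. Its energy \<open>\<integral> a0'\<^sup>2 - g a0\<^sup>2\<close> vanishes, but \<open>a0\<close> does not
  solve the equation: it has a corner at \<open>m\<close>, and pairing it with the operator applied to \<open>\<eta>\<close> gives
  \<open>b m * \<eta> m\<close>, which is nonzero. So a small multiple of \<open>\<eta>\<close>, with the right sign, makes the energy
  negative to first order. As \<open>a0\<close> is not in the operator domain, \<open>a\<close> is replaced by the functions
  \<open>p n = a - \<delta> n * arctan (a / \<delta> n)\<close> before cutting, with \<open>\<delta> n\<close> tending to zero.
\<close>

lemma dirichlet_negative_direction:
  fixes a b g :: "real \<Rightarrow> real"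
  assumes d1: "\<And>x. x \<in> {0..l} \<Longrightarrow> (a has_vector_derivative b x) (at x within {0..l})"
    and d2: "\<And>x. x \<in> {0..l} \<Longrightarrow> (b has_vector_derivative - (g x * a x)) (at x within {0..l})"
    and g: "continuous_on {0..l} g" and a0: "a 0 = 0" and m: "m \<in> {0<..<l}" "a m = 0" "b m \<noteq> 0"
  obtains u v where "(u, v) \<in> dirichlet_op l g" "ip l v u < 0"
proof -
  have l: "l > 0" and m0: "0 < m" "m \<le> l" "m \<ge> 0" using m by auto
  have sub: "{0..m} \<subseteq> {0..l}" using m by auto
  have ca: "continuous_on {0..l} a" "continuous_on {0..l} b"
    using d1 d2 by (meson continuous_on_eq_continuous_within has_vector_derivative_continuous)+
  note cam = continuous_on_subset[OF ca(1) sub] continuous_on_subset[OF ca(2) sub] continuous_on_subset[OF g sub]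
  have e1: "(a has_real_derivative b x) (at x within {0..m})" if "x \<in> {0..m}" for x
    using has_vector_derivative_within_subset[OF d1 sub] that sub
    by (auto simp: has_real_derivative_iff_has_vector_derivative)
  have e2: "(b has_real_derivative - (g x * a x)) (at x within {0..m})" if "x \<in> {0..m}" for x
    using has_vector_derivative_within_subset[OF d2 sub] that sub
    by (auto simp: has_real_derivative_iff_has_vector_derivative)
  define \<delta> where "\<delta> n = 1 / real (Suc n)" for n
  have \<delta>: "\<delta> n > 0" "\<delta> n \<le> 1" for n by (auto simp: \<delta>_def)
  have \<delta>lim: "\<delta> \<longlonglongrightarrow> 0" unfolding \<delta>_def using LIMSEQ_Suc[OF lim_1_over_n] by simp
  define p where "p n x = a x - \<delta> n * arctan (a x / \<delta> n)" for n x
  define F1 where "F1 n y = y\<^sup>2 / (y\<^sup>2 + (\<delta> n)\<^sup>2)" for n y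
  define F2 where "F2 n y = 2 * y * (\<delta> n)\<^sup>2 / (y\<^sup>2 + (\<delta> n)\<^sup>2)\<^sup>2" for n y
  define p1 where "p1 n x = F1 n (a x) * b x" for n x
  define p2 where "p2 n x = F2 n (a x) * b x * b x + F1 n (a x) * (- (g x * a x))" for n x
  have p0: "p n 0 = 0" "p n m = 0" "p1 n m = 0" "p2 n m = 0" for n
    using a0 m by (auto simp: p_def p1_def p2_def F1_def F2_def)
  have dp: "(p n has_vector_derivative p1 n x) (at x within {0..m})" if "x \<in> {0..m}" for n x
    unfolding has_real_derivative_iff_has_vector_derivative[symmetric] p_def p1_def F1_def
    by (rule DERIV_chain2[OF DERIV_shrink(1)[OF \<delta>(1)] e1[OF that]])
  have dp1: "(p1 n has_vector_derivative p2 n x) (at x within {0..m})" if "x \<in> {0..m}" for n x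
  proof -
    have "((\<lambda>x. F1 n (a x)) has_real_derivative F2 n (a x) * b x) (at x within {0..m})"
      unfolding F1_def F2_def by (rule DERIV_chain2[OF DERIV_shrink(2)[OF \<delta>(1)] e1[OF that]])
    from DERIV_mult[OF this e2[OF that]] show ?thesis
      unfolding has_real_derivative_iff_has_vector_derivative[symmetric] p1_def p2_def
      by (simp add: algebra_simps)
  qed
  have pos: "y\<^sup>2 + (\<delta> n)\<^sup>2 > 0" for y n using \<delta>(1)[of n] by (simp add: add_nonneg_pos)
  have nz: "y\<^sup>2 + (\<delta> n)\<^sup>2 \<noteq> 0" for y n using pos[of y n] by linarith
  have cF: "continuous_on {0..l} (\<lambda>x. F1 n (a x))" "continuous_on {0..l} (\<lambda>x. F2 n (a x))" for n
    unfolding F1_def F2_def using nz by (auto intro!: continuous_intros ca)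
  have cp2: "continuous_on {0..l} (p2 n)" for n unfolding p2_def by (intro continuous_intros cF ca g)
  have cp1: "continuous_on {0..l} (p1 n)" for n unfolding p1_def by (intro continuous_intros cF ca)
  have cp: "continuous_on {0..l} (p n)" for n
    unfolding p_def by (intro continuous_intros ca) (use \<delta>(1) in \<open>auto simp: less_imp_neq[symmetric]\<close>)
  have cpm: "continuous_on {0..m} (p n)" "continuous_on {0..m} (p1 n)" "continuous_on {0..m} (p2 n)" for n
    using continuous_on_subset[OF _ sub] cp cp1 cp2 by blast+
  define q where "q f x = (if x < m then f x else 0)" for f :: "real \<Rightarrow> real" and x
  have dq: "(q (p n) has_vector_derivative q (p1 n) x) (at x within {0..l})" if "x \<in> {0..l}" for n x
    unfolding q_def by (rule has_vector_derivative_cut[OF dp p0(2,3) m0(1,2) that])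
  have dq1: "(q (p1 n) has_vector_derivative q (p2 n) x) (at x within {0..l})" if "x \<in> {0..l}" for n x
    unfolding q_def by (rule has_vector_derivative_cut[OF dp1 p0(3,4) m0(1,2) that])
  have cq2: "continuous_on {0..l} (q (p2 n))" for n
  proof -
    have eq: "{0..l} = {0..m} \<union> {m..l}" using m by auto
    have "continuous_on ({0..m} \<union> {m..l}) (\<lambda>x. if x \<le> m then p2 n x else 0)"
    proof (rule continuous_on_If[OF _ _ cpm(3)])
      fix x assume "x \<in> {m..l}" "x \<le> m"
      then have "x = m" by simp
      then show "p2 n x = 0" using p0(4) by simp
    qed simp_all
    moreover have "(\<lambda>x. if x \<le> m then p2 n x else 0) = q (p2 n)"
      using p0(4)[of n] by (auto simp: q_def fun_eq_iff)
    ultimately show ?thesis unfolding eq by (simp only:)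
  qed
  let ?c = "complex_of_real"
  define \<eta> where "\<eta> x = x * (l - x)" for x
  define w where "w x = 2 - g x * \<eta> x" for x
  have c\<eta>: "continuous_on S \<eta>" for S unfolding \<eta>_def by (intro continuous_intros)
  have cw: "continuous_on {0..l} w" unfolding w_def by (intro continuous_intros g c\<eta>)
  have D1: "(\<lambda>x. ?c (q (p n) x), \<lambda>x. ?c (- q (p2 n) x - g x * q (p n) x)) \<in> dirichlet_op l g" for n
    by (rule dirichlet_classical[OF l dq dq1 cq2 g]) (use p0 m in \<open>auto simp: q_def\<close>)
  have D2: "(\<lambda>x. ?c (\<eta> x), \<lambda>x. ?c (w x)) \<in> dirichlet_op l g"
  proof -
    have "(\<lambda>x. ?c (\<eta> x), \<lambda>x. ?c (- (- 2) - g x * \<eta> x)) \<in> dirichlet_op l g"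
    proof (rule dirichlet_classical[OF l _ _ _ g])
      show "(\<eta> has_vector_derivative l - 2 * x) (at x within {0..l})" for x
        unfolding has_real_derivative_iff_has_vector_derivative[symmetric] \<eta>_def
        by (rule derivative_eq_intros refl)+ simp
      show "((\<lambda>x. l - 2 * x) has_vector_derivative - 2) (at x within {0..l})" for x
        unfolding has_real_derivative_iff_has_vector_derivative[symmetric]
        by (rule derivative_eq_intros refl)+ simp
    qed (auto simp: \<eta>_def)
    then show ?thesis by (simp add: w_def)
  qed
  \<comment> \<open>The energy at \<open>q (p n) + \<epsilon> \<eta>\<close> is at most \<open>R n + 2 \<epsilon> T n + \<epsilon>\<^sup>2 C\<close>, where \<open>w\<close> is the operator
    applied to \<open>\<eta>\<close>.\<close>
  define C where "C = (\<integral>x. w x * \<eta> x \<partial>(meas l))"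
  define R where "R n = (\<integral>x. (b x)\<^sup>2 - g x * (p n x)\<^sup>2 \<partial>(meas m))" for n
  define T where "T n = (\<integral>x. p n x * w x \<partial>(meas m))" for n
  have energy: "ip l (\<lambda>x. ?c (- q (p2 n) x - g x * q (p n) x)) (\<lambda>x. ?c (q (p n) x)) \<le> R n" for n
  proof -
    have "ip l (\<lambda>x. ?c (- q (p2 n) x - g x * q (p n) x)) (\<lambda>x. ?c (q (p n) x))
        = (\<integral>x. (if x < m then (- p2 n x - g x * p n x) * p n x else 0) \<partial>(meas l))"
      unfolding ip_of_real by (rule Bochner_Integration.integral_cong) (auto simp: q_def)
    also have "\<dots> = (\<integral>x. (- p2 n x - g x * p n x) * p n x \<partial>(meas m))"
      by (rule integral_meas_cut[OF m0(2)])
    also have "\<dots> = (\<integral>x. (p1 n x)\<^sup>2 - g x * (p n x)\<^sup>2 \<partial>(meas m))"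
      by (rule dirichlet_energy_classical[OF m0(1) dp dp1 cpm(3) cam(3) p0(1,2)])
    \<comment> \<open>Here the bound \<open>F1 \<le> 1\<close> on the derivative of the shrinking map enters.\<close>
    also have "\<dots> \<le> R n"
      unfolding R_def
    proof (rule integral_mono)
      show "integrable (meas m) (\<lambda>x. (p1 n x)\<^sup>2 - g x * (p n x)\<^sup>2)"
        by (intro continuous_on_integrable_meas continuous_intros cpm cam)
      show "integrable (meas m) (\<lambda>x. (b x)\<^sup>2 - g x * (p n x)\<^sup>2)"
        by (intro continuous_on_integrable_meas continuous_intros cpm cam)
      fix x
      have "0 \<le> F1 n (a x)" "F1 n (a x) \<le> 1"
        unfolding F1_def using pos[of "a x" n] by (auto simp: divide_le_eq_1)
      then have "(F1 n (a x))\<^sup>2 \<le> 1" by (simp add: power_le_one)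
      then have "(F1 n (a x))\<^sup>2 * (b x)\<^sup>2 \<le> 1 * (b x)\<^sup>2" by (rule mult_right_mono) simp
      then show "(p1 n x)\<^sup>2 - g x * (p n x)\<^sup>2 \<le> (b x)\<^sup>2 - g x * (p n x)\<^sup>2"
        by (simp add: p1_def power_mult_distrib)
    qed
    finally show ?thesis .
  qed
  have cross: "ip l (\<lambda>x. ?c (q (p n) x)) (\<lambda>x. ?c (w x)) = T n" for n
  proof -
    have "ip l (\<lambda>x. ?c (q (p n) x)) (\<lambda>x. ?c (w x)) = (\<integral>x. (if x < m then p n x * w x else 0) \<partial>(meas l))"
      unfolding ip_of_real by (rule Bochner_Integration.integral_cong) (auto simp: q_def)
    then show ?thesis unfolding T_def integral_meas_cut[OF m0(2)] .
  qed
  obtain A where A: "A > 0" "\<And>x. x \<in> {0..l} \<Longrightarrow> norm (a x) \<le> A"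
    using continuous_on_interval_bound[OF ca(1)] by blast
  have pA: "norm (p n x) \<le> A + 2" if "x \<in> {0..m}" for n x
  proof -
    have "norm (a x) \<le> A" using A(2) that sub by blast
    then show ?thesis using shrink_near_identity[OF \<delta>(1)[of n], of "a x"] \<delta>(2)[of n]
      unfolding p_def real_norm_def by linarith
  qed
  have plim: "(\<lambda>n. p n x) \<longlonglongrightarrow> a x" for x
  proof -
    have "(\<lambda>n. p n x - a x) \<longlonglongrightarrow> 0"
    proof (rule Lim_null_comparison)
      show "\<forall>\<^sub>F n in sequentially. norm (p n x - a x) \<le> 2 * \<delta> n"
        using shrink_near_identity[OF \<delta>(1)] unfolding p_def real_norm_def by (intro always_eventually allI)
      show "(\<lambda>n. 2 * \<delta> n) \<longlonglongrightarrow> 0" using tendsto_mult_right_zero[OF \<delta>lim] .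
    qed
    then show ?thesis by (simp add: LIM_zero_iff)
  qed
  have c1: "continuous_on {0..m} (\<lambda>_. c)" for c :: real by simp
  have Rlim: "R \<longlonglongrightarrow> 0"
  proof -
    obtain K where K: "K > 0" "\<And>x. x \<in> {0..m} \<Longrightarrow> norm (g x) \<le> K"
      using continuous_on_interval_bound[OF cam(3)] by blast
    obtain Bb where Bb: "Bb > 0" "\<And>x. x \<in> {0..m} \<Longrightarrow> norm (b x) \<le> Bb"
      using continuous_on_interval_bound[OF cam(2)] by blast
    have "R \<longlonglongrightarrow> (\<integral>x. (b x)\<^sup>2 - g x * (a x)\<^sup>2 \<partial>(meas m))"
      unfolding R_def
    proof (rule integral_dominated_convergence[where w = "\<lambda>_. Bb\<^sup>2 + K * (A + 2)\<^sup>2"])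
      show "AE x in meas m. (\<lambda>n. (b x)\<^sup>2 - g x * (p n x)\<^sup>2) \<longlonglongrightarrow> (b x)\<^sup>2 - g x * (a x)\<^sup>2"
        by (intro AE_I2 tendsto_intros plim)
      show "AE x in meas m. norm ((b x)\<^sup>2 - g x * (p n x)\<^sup>2) \<le> Bb\<^sup>2 + K * (A + 2)\<^sup>2" for n
      proof (rule AE_I2)
        fix x assume "x \<in> space (meas m)"
        then have x: "x \<in> {0..m}" by auto
        have "norm (g x * (p n x)\<^sup>2) \<le> K * (A + 2)\<^sup>2"
          unfolding norm_mult norm_power
          by (rule mult_mono[OF K(2)[OF x] power_mono[OF pA[OF x] norm_ge_zero]]) (use K in simp_all)
        moreover have "norm ((b x)\<^sup>2) \<le> Bb\<^sup>2" unfolding norm_power by (rule power_mono[OF Bb(2)[OF x] norm_ge_zero])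
        ultimately show "norm ((b x)\<^sup>2 - g x * (p n x)\<^sup>2) \<le> Bb\<^sup>2 + K * (A + 2)\<^sup>2"
          using norm_triangle_ineq4[of "(b x)\<^sup>2" "g x * (p n x)\<^sup>2"] by linarith
      qed
      show "(\<lambda>x. (b x)\<^sup>2 - g x * (a x)\<^sup>2) \<in> borel_measurable (meas m)"
        by (intro continuous_on_measurable_meas continuous_intros cam)
      show "(\<lambda>x. (b x)\<^sup>2 - g x * (p n x)\<^sup>2) \<in> borel_measurable (meas m)" for n
        by (intro continuous_on_measurable_meas continuous_intros cam cpm)
    qed (rule continuous_on_integrable_meas[OF c1])
    also have "(\<integral>x. (b x)\<^sup>2 - g x * (a x)\<^sup>2 \<partial>(meas m)) = a m * b m - a 0 * b 0"
    proof (rule integral_meas_FTC[OF m0(3)])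
      fix x assume x: "x \<in> {0..m}"
      have "((\<lambda>x. a x * b x) has_real_derivative b x * b x + - (g x * a x) * a x) (at x within {0..m})"
        by (rule DERIV_mult[OF e1[OF x] e2[OF x]])
      then show "((\<lambda>x. a x * b x) has_vector_derivative (b x)\<^sup>2 - g x * (a x)\<^sup>2) (at x within {0..m})"
        unfolding has_real_derivative_iff_has_vector_derivative[symmetric]
        by (simp add: power2_eq_square algebra_simps)
    qed (intro continuous_intros cam)
    finally show ?thesis using a0 m by simp
  qed
  define M where "M = b m * \<eta> m"
  have "\<eta> m \<noteq> 0" using m by (auto simp: \<eta>_def)
  then have M: "M \<noteq> 0" using m(3) by (simp add: M_def)
  have Tlim: "T \<longlonglongrightarrow> M"
  proof -
    have cwm: "continuous_on {0..m} w" by (rule continuous_on_subset[OF cw sub])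
    obtain K where K: "K > 0" "\<And>x. x \<in> {0..m} \<Longrightarrow> norm (w x) \<le> K"
      using continuous_on_interval_bound[OF cwm] by blast
    have "T \<longlonglongrightarrow> (\<integral>x. a x * w x \<partial>(meas m))"
      unfolding T_def
    proof (rule integral_dominated_convergence[where w = "\<lambda>_. (A + 2) * K"])
      show "AE x in meas m. (\<lambda>n. p n x * w x) \<longlonglongrightarrow> a x * w x"
        by (intro AE_I2 tendsto_intros plim)
      show "AE x in meas m. norm (p n x * w x) \<le> (A + 2) * K" for n
      proof (rule AE_I2)
        fix x assume "x \<in> space (meas m)"
        then have x: "x \<in> {0..m}" by auto
        show "norm (p n x * w x) \<le> (A + 2) * K"
          unfolding norm_mult by (rule mult_mono[OF pA[OF x] K(2)[OF x]]) (use A in simp_all)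
      qed
      show "(\<lambda>x. a x * w x) \<in> borel_measurable (meas m)"
        by (intro continuous_on_measurable_meas continuous_intros cam cwm)
      show "(\<lambda>x. p n x * w x) \<in> borel_measurable (meas m)" for n
        by (intro continuous_on_measurable_meas continuous_intros cwm cpm)
    qed (rule continuous_on_integrable_meas[OF c1])
    also have "(\<integral>x. a x * w x \<partial>(meas m))
        = (b m * \<eta> m - a m * (l - 2 * m)) - (b 0 * \<eta> 0 - a 0 * (l - 2 * 0))"
    proof (rule integral_meas_FTC[OF m0(3)])
      fix x assume x: "x \<in> {0..m}"
      have "((\<lambda>x. b x * (x * (l - x)) - a x * (l - 2 * x)) has_real_derivative
          a x * (2 - g x * (x * (l - x)))) (at x within {0..m})"
        by (rule derivative_eq_intros e1[OF x] e2[OF x] refl)+ (simp add: algebra_simps)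
      then show "((\<lambda>x. b x * \<eta> x - a x * (l - 2 * x)) has_vector_derivative a x * w x) (at x within {0..m})"
        unfolding has_real_derivative_iff_has_vector_derivative[symmetric] \<eta>_def w_def .
    qed (intro continuous_intros cam cwm)
    finally show ?thesis using a0 m(2) by (simp add: M_def \<eta>_def)
  qed
  \<comment> \<open>The limit of the bound is \<open>2 \<epsilon> M + \<epsilon>\<^sup>2 C\<close>, with \<open>M = b m * \<eta> m\<close>. Taking \<open>\<epsilon> = - t M\<close> makes it
    \<open>t M\<^sup>2 (t C - 2)\<close>, which is negative once \<open>t C \<le> 1\<close>.\<close>
  define t where "t = 1 / (1 + \<bar>C\<bar>)"
  define \<epsilon> where "\<epsilon> = - t * M"
  have t: "t > 0" "t * C \<le> 1"
  proof -
    have "0 < 1 + \<bar>C\<bar>" "C \<le> 1 + \<bar>C\<bar>" by linarith+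
    then show "t > 0" "t * C \<le> 1" by (simp_all add: t_def pos_divide_le_eq)
  qed
  have "(\<lambda>n. R n + 2 * \<epsilon> * T n + \<epsilon>\<^sup>2 * C) \<longlonglongrightarrow> 0 + 2 * \<epsilon> * M + \<epsilon>\<^sup>2 * C"
    by (intro tendsto_intros Rlim Tlim)
  moreover have "0 + 2 * \<epsilon> * M + \<epsilon>\<^sup>2 * C < 0"
  proof -
    have "0 + 2 * \<epsilon> * M + \<epsilon>\<^sup>2 * C = t * M\<^sup>2 * (t * C - 2)"
      by (simp add: \<epsilon>_def power2_eq_square algebra_simps)
    also have "\<dots> < 0" using t M by (intro mult_pos_neg mult_pos_pos) auto
    finally show ?thesis .
  qed
  ultimately have "\<forall>\<^sub>F n in sequentially. R n + 2 * \<epsilon> * T n + \<epsilon>\<^sup>2 * C < 0"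
    by (rule order_tendstoD(2))
  then obtain n where n: "R n + 2 * \<epsilon> * T n + \<epsilon>\<^sup>2 * C < 0"
    by (auto simp: eventually_sequentially)
  define U where "U x = ?c (q (p n) x)" for x
  define V where "V x = ?c (- q (p2 n) x - g x * q (p n) x)" for x
  define Y where "Y x = ?c (\<eta> x)" for x
  define W where "W x = ?c (w x)" for x
  have UV: "(U, V) \<in> dirichlet_op l g" using D1[of n] by (simp add: U_def[abs_def] V_def[abs_def])
  have YW: "(Y, W) \<in> dirichlet_op l g" using D2 by (simp add: Y_def[abs_def] W_def[abs_def])
  note LU = dirichlet_op_L2(1,2)[OF UV] and LY = dirichlet_op_L2(1,2)[OF YW]
  have "ip l V Y = ip l U W" by (rule dirichlet_symmetric[OF UV YW g l])
  moreover have "ip l U W = T n" using cross[of n] by (simp add: U_def[abs_def] W_def[abs_def])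
  moreover have "ip l W Y = C" unfolding W_def Y_def ip_of_real C_def ..
  moreover have "ip l V U \<le> R n" using energy[of n] by (simp add: U_def[abs_def] V_def[abs_def])
  moreover have "ip l (\<lambda>x. V x + \<epsilon> *\<^sub>R W x) (\<lambda>x. U x + \<epsilon> *\<^sub>R Y x)
      = ip l V U + \<epsilon> * ip l V Y + \<epsilon> * ip l U W + \<epsilon>\<^sup>2 * ip l W Y"
    using LU LY by (simp add: ip_linear L2_add L2_scaleR ip_commute[of l W U] power2_eq_square algebra_simps)
  ultimately have "ip l (\<lambda>x. V x + \<epsilon> *\<^sub>R W x) (\<lambda>x. U x + \<epsilon> *\<^sub>R Y x) < 0" using n by simp
  then show ?thesis using that[OF dirichlet_lincomb[OF UV YW l]] by blast
qed

section \<open>Unstable spectrum of the block operator\<close>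

text \<open>
  With $A$ denoting the inverse of the operator, so that \<open>w = A u\<close>, this is the interpolation
  inequality $\|u\|^4 \le \langle A u, u\rangle \langle A^{-1} u, u\rangle$. It is the
  Cauchy--Schwarz inequality for the nonnegative form of the operator, applied to \<open>w\<close> and \<open>u\<close>.
\<close>

lemma dirichlet_Cauchy_Schwarz:
  assumes l: "l > 0" and h: "continuous_on {0..l} h"
    and nonneg: "\<And>w a. (w, a) \<in> dirichlet_op l h \<Longrightarrow> ip l a w \<ge> 0"
    and wa: "(w, u) \<in> dirichlet_op l h" and ua: "(u, a) \<in> dirichlet_op l h"
  shows "(ip l u u)\<^sup>2 \<le> ip l u w * ip l a u"
proof (rule discriminant_nonneg_quadratic)
  note L = dirichlet_op_L2(1,2)[OF wa] dirichlet_op_L2(2)[OF ua]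
  fix t :: real
  have "ip l a w = ip l u u" by (rule dirichlet_symmetric[OF ua wa h l])
  then have "ip l (\<lambda>x. u x + t *\<^sub>R a x) (\<lambda>x. w x + t *\<^sub>R u x) = ip l u w + 2 * t * ip l u u + t\<^sup>2 * ip l a u"
    using L by (simp add: ip_linear L2_add L2_scaleR power2_eq_square algebra_simps)
  then show "0 \<le> ip l u w + 2 * t * ip l u u + t\<^sup>2 * ip l a u"
    using nonneg[OF dirichlet_lincomb[OF wa ua l, of t]] by simp
qed (rule nonneg[OF ua])

lemma L2_pair_zero:
  fixes u :: "real \<Rightarrow> complex"
  assumes "u \<in> L2 l"
  shows "(\<lambda>x. (0 :: complex, u x)) \<in> L2 l" "L2_norm l (\<lambda>x. (0 :: complex, u x)) = L2_norm l u"
proof -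
  have "(\<lambda>x. (0 :: complex, u x)) \<in> borel_measurable (meas l)"
    using L2_D(1)[OF assms] by (intro borel_measurable_Pair) auto
  then show "(\<lambda>x. (0 :: complex, u x)) \<in> L2 l"
    using L2_D(2)[OF assms] by (simp add: L2_def norm_prod_def)
  show "L2_norm l (\<lambda>x. (0 :: complex, u x)) = L2_norm l u"
    by (simp add: L2_norm_def norm_prod_def)
qed

lemma L2_norm_fst_le:
  fixes p q :: "real \<Rightarrow> complex"
  assumes "p \<in> L2 l" "q \<in> L2 l"
  shows "L2_norm l p \<le> L2_norm l (\<lambda>x. (p x, q x))"
  unfolding L2_norm_def norm_prod_def
proof (rule real_sqrt_le_mono, rule integral_mono)
  show "integrable (meas l) (\<lambda>x. (cmod (p x))\<^sup>2)" by (rule L2_D(2)[OF assms(1)])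
  show "integrable (meas l) (\<lambda>x. (sqrt ((cmod (fst (p x, q x)))\<^sup>2 + (cmod (snd (p x, q x)))\<^sup>2))\<^sup>2)"
    using L2_D(2)[OF assms(1)] L2_D(2)[OF assms(2)] by simp
qed simp

text \<open>
  The operator $N$ for arbitrary potentials \<open>g\<close> of $L_+$ and \<open>h\<close> of $L_-$.
\<close>

definition block_op ::
  "real \<Rightarrow> (real \<Rightarrow> real) \<Rightarrow> (real \<Rightarrow> real) \<Rightarrow>
   ((real \<Rightarrow> complex \<times> complex) \<times> (real \<Rightarrow> complex \<times> complex)) set" where
  "block_op l g h =
     {(\<lambda>x. (u x, w x), \<lambda>x. (- a x, b x)) | u w a b.
        (w, a) \<in> dirichlet_op l h \<and> (u, b) \<in> dirichlet_op l g}"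

text \<open>
  Eliminating the second component. If $(N - \lambda)(p, q) = (0, u)$, then $y = - q / \lambda$
  satisfies $L_- y = p$ and $L_+ p + \lambda^2 y = u$. So a resolvent point $\lambda$ of $N$ yields a
  bounded right inverse of $L_+ + \lambda^2 L_-^{-1}$.
\<close>

lemma block_op_resolvent:
  fixes lam :: real
  assumes l: "l > 0" and lam: "lam > 0"
    and inv: "complex_of_real lam \<notin> spectrum l pair_scale (block_op l g h)"
  obtains C where "C > 0"
    "\<And>u. u \<in> L2 l \<Longrightarrow> \<exists>p c y. (p, c) \<in> dirichlet_op l g \<and> (y, p) \<in> dirichlet_op l h \<and>
       (\<forall>x. c x + lam\<^sup>2 *\<^sub>R y x = u x) \<and> L2_norm l p \<le> C * L2_norm l u"
proof -
  define R where "R = {(U, \<lambda>x. V x - pair_scale (complex_of_real lam) (U x)) | U V. (U, V) \<in> block_op l g h}"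
  have "boundedly_invertible l R"
    using inv unfolding spectrum_def R_def by (simp only: mem_Collect_eq not_not)
  then have R: "\<forall>W\<in>L2 l. \<exists>U. (U, W) \<in> R" "\<exists>C. \<forall>(U, W)\<in>R. L2_norm l U \<le> C * L2_norm l W"
    unfolding boundedly_invertible_def by (rule conjunct1, elim conjE)
  from R(2) obtain C0 where C0: "\<And>U W. (U, W) \<in> R \<Longrightarrow> L2_norm l U \<le> C0 * L2_norm l W"
    by auto
  define C where "C = \<bar>C0\<bar> + 1"
  have ex: "\<exists>p c y. (p, c) \<in> dirichlet_op l g \<and> (y, p) \<in> dirichlet_op l h \<and>
       (\<forall>x. c x + lam\<^sup>2 *\<^sub>R y x = u x) \<and> L2_norm l p \<le> C * L2_norm l u" if u: "u \<in> L2 l" for u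
  proof -
    obtain U where UW: "(U, \<lambda>x. (0, u x)) \<in> R" using bspec[OF R(1) L2_pair_zero(1)[OF u]] by (elim exE)
    then obtain V where V: "(\<lambda>x. (0, u x)) = (\<lambda>x. V x - pair_scale (complex_of_real lam) (U x))"
      "(U, V) \<in> block_op l g h"
      unfolding R_def mem_Collect_eq prod.inject by (elim exE conjE) simp
    from V(2) obtain p q a c where pq: "U = (\<lambda>x. (p x, q x))" "V = (\<lambda>x. (- a x, c x))"
      "(q, a) \<in> dirichlet_op l h" "(p, c) \<in> dirichlet_op l g"
      unfolding block_op_def mem_Collect_eq prod.inject by (elim exE conjE)
    have eq: "a x = - (lam *\<^sub>R p x)" "c x = u x + lam *\<^sub>R q x" for x
    proof -
      have "(0, u x) = V x - pair_scale (complex_of_real lam) (U x)" using fun_cong[OF V(1), of x] .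
      then have "0 = - a x - complex_of_real lam * p x" "u x = c x - complex_of_real lam * q x"
        by (simp_all add: pq(1,2) pair_scale_def)
      then show "a x = - (lam *\<^sub>R p x)" "c x = u x + lam *\<^sub>R q x"
        by (simp_all add: scaleR_conv_of_real algebra_simps eq_neg_iff_add_eq_0)
    qed
    define y where "y x = - ((1 / lam) *\<^sub>R q x)" for x
    have "(\<lambda>x. q x + (- 1 - 1 / lam) *\<^sub>R q x, \<lambda>x. a x + (- 1 - 1 / lam) *\<^sub>R a x) \<in> dirichlet_op l h"
      by (rule dirichlet_lincomb[OF pq(3,3) l])
    moreover have "(\<lambda>x. q x + (- 1 - 1 / lam) *\<^sub>R q x) = y"
      by (rule ext) (simp add: y_def scaleR_diff_left)
    moreover have "(\<lambda>x. a x + (- 1 - 1 / lam) *\<^sub>R a x) = p"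
    proof
      fix x
      have "(- 1 - 1 / lam) * lam = - lam - 1" using lam by (simp add: left_diff_distrib)
      then show "a x + (- 1 - 1 / lam) *\<^sub>R a x = p x" by (simp add: eq(1) scaleR_diff_left)
    qed
    ultimately have "(y, p) \<in> dirichlet_op l h" by simp
    moreover have "c x + lam\<^sup>2 *\<^sub>R y x = u x" for x
      using lam by (simp add: eq(2) y_def power2_eq_square)
    moreover have "L2_norm l p \<le> C * L2_norm l u"
    proof -
      have "L2_norm l p \<le> L2_norm l U"
        unfolding pq(1) by (rule L2_norm_fst_le[OF dirichlet_op_L2(1)[OF pq(4)] dirichlet_op_L2(1)[OF pq(3)]])
      also have "\<dots> \<le> C0 * L2_norm l u" using C0[OF UW] L2_pair_zero(2)[OF u] by simp
      also have "\<dots> \<le> C * L2_norm l u" by (rule mult_right_mono) (simp_all add: C_def L2_norm_nonneg)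
      finally show ?thesis .
    qed
    ultimately show ?thesis using pq(4) by blast
  qed
  have "C > 0" by (simp add: C_def)
  then show ?thesis using ex by (rule that)
qed

text \<open>
  Put $A = L_-^{-1}$ and let $\mu \ge 0$ be the smallest number for which the form of $L_+ + \mu A$ is
  nonnegative. It exists, because the interpolation inequality bounds the difference of $L_+$ and
  $L_-$, which is a bounded multiplication, by the forms of $L_-$ and of a multiple of $A$; and it
  is positive, because $L_+$ has a negative direction. If $\lambda = \sqrt\mu$ were not in the spectrum
  of $N$, then the nonnegative symmetric operator $L_+ + \mu A$ would have a bounded right inverse,
  hence its form would be bounded below by a positive multiple of $\|u\|^2$. But then $\mu$ could be
  decreased, since $A$ is bounded. In this way $\lambda$ is found in the spectrum without a minimizer
  or any compactness.
  
  The predicate \<open>T u b w\<close> in the proof says that \<open>b\<close> is $L_+ u$ and that \<open>w\<close> is $A u$; working with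
  such triples avoids choosing representatives of $A u$.
\<close>

proposition positive_spectrum_of_block_operator:
  assumes l: "l > 0" and g: "continuous_on {0..l} g" and h: "continuous_on {0..l} h"
    and nonneg: "\<And>w a. (w, a) \<in> dirichlet_op l h \<Longrightarrow> ip l a w \<ge> 0"
    and inv: "boundedly_invertible l (dirichlet_op l h)"
    and neg: "(u0, b0) \<in> dirichlet_op l g" "ip l b0 u0 < 0"
  obtains lam :: real where "lam > 0"
    "complex_of_real lam \<in> spectrum l pair_scale (block_op l g h)"
proof -
  define T where "T u b w \<longleftrightarrow> (u, b) \<in> dirichlet_op l g \<and> (w, u) \<in> dirichlet_op l h" for u b w
  have TL: "u \<in> L2 l" "b \<in> L2 l" "w \<in> L2 l" if "T u b w" for u b w
    using that dirichlet_op_L2(1,2) unfolding T_def by blast+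
  have Tw: "ip l w u \<ge> 0" if "T u b w" for u b w
    using nonneg[of w u] that by (simp add: T_def ip_commute[of l w u])
  obtain C0 where C0: "\<And>w a. (w, a) \<in> dirichlet_op l h \<Longrightarrow> L2_norm l w \<le> C0 * L2_norm l a"
    using inv unfolding boundedly_invertible_def by blast
  have surj: "\<exists>w. (w, u) \<in> dirichlet_op l h" if "u \<in> L2 l" for u
    using inv that unfolding boundedly_invertible_def by blast
  define C1 where "C1 = \<bar>C0\<bar> + 1"
  have C1: "C1 > 0" by (simp add: C1_def)
  have wbound: "ip l w u \<le> C1 * ip l u u" if t: "T u b w" for u b w
  proof -
    have "L2_norm l w \<le> C0 * L2_norm l u" using C0[of w u] t by (simp add: T_def)
    also have "\<dots> \<le> C1 * L2_norm l u" by (rule mult_right_mono) (simp_all add: C1_def L2_norm_nonneg)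
    finally have "L2_norm l w * L2_norm l u \<le> C1 * L2_norm l u * L2_norm l u"
      by (rule mult_right_mono) (rule L2_norm_nonneg)
    also have "\<dots> = C1 * ip l u u" by (simp add: L2_norm_sq[symmetric] power2_eq_square)
    finally show ?thesis using ip_Cauchy_Schwarz[OF TL(3,1)[OF t]] by linarith
  qed
  define S where "S = {\<mu>. \<mu> \<ge> 0 \<and> (\<forall>u b w. T u b w \<longrightarrow> ip l b u + \<mu> * ip l w u \<ge> 0)}"
  have "S \<noteq> {}"
  proof -
    \<comment> \<open>$B^2 / 4$ is an admissible value: $B \|u\|^2 \le \langle L_- u, u\rangle + (B^2/4) \langle A u, u\rangle$
      by interpolation and the inequality of arithmetic and geometric means.\<close>
    obtain B where B: "B > 0"
      "\<And>u :: real \<Rightarrow> complex. u \<in> L2 l \<Longrightarrow> L2_norm l (\<lambda>x. of_real (g x - h x) * u x) \<le> B * L2_norm l u"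
      using L2_norm_mult_continuous[OF continuous_on_diff[OF g h]] by blast
    have "ip l b u + B\<^sup>2 / 4 * ip l w u \<ge> 0" if t: "T u b w" for u b w
    proof -
      let ?V = "\<lambda>x. of_real (g x - h x) * u x"
      define a where "a x = b x + ?V x" for x
      have ua: "(u, a) \<in> dirichlet_op l h" and wu: "(w, u) \<in> dirichlet_op l h"
        using dirichlet_change_potential[OF _ g h, of u b] t unfolding T_def a_def[abs_def] by blast+
      have V: "?V \<in> L2 l" by (rule L2_mult_continuous[OF TL(1)[OF t] continuous_on_diff[OF g h]])
      have "ip l ?V u \<le> L2_norm l ?V * L2_norm l u"
        using ip_Cauchy_Schwarz[OF V TL(1)[OF t]] by linarith
      also have "\<dots> \<le> B * L2_norm l u * L2_norm l u"
        by (rule mult_right_mono[OF B(2)[OF TL(1)[OF t]] L2_norm_nonneg])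
      finally have 1: "ip l ?V u \<le> B * ip l u u" by (simp add: L2_norm_sq[symmetric] power2_eq_square)
      have 2: "ip l a u = ip l b u + ip l ?V u"
        unfolding a_def[abs_def] by (rule ip_linear(1)[OF TL(2)[OF t] V TL(1)[OF t]])
      have 3: "B * ip l u u \<le> ip l a u + B\<^sup>2 / 4 * ip l w u"
      proof (rule power2_le_imp_le)
        have "(B * ip l u u)\<^sup>2 \<le> B\<^sup>2 * (ip l u w * ip l a u)"
          unfolding power_mult_distrib
          by (rule mult_left_mono[OF dirichlet_Cauchy_Schwarz[OF l h nonneg wu ua]]) simp_all
        also have "\<dots> \<le> B\<^sup>2 * (ip l u w * ip l a u) + (ip l a u - B\<^sup>2 / 4 * ip l w u)\<^sup>2" by simp
        also have "\<dots> = (ip l a u + B\<^sup>2 / 4 * ip l w u)\<^sup>2"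
          by (simp add: ip_commute[of l u w] power2_eq_square algebra_simps)
        finally show "(B * ip l u u)\<^sup>2 \<le> (ip l a u + B\<^sup>2 / 4 * ip l w u)\<^sup>2" .
        show "0 \<le> ip l a u + B\<^sup>2 / 4 * ip l w u" using nonneg[OF ua] Tw[OF t] by simp
      qed
      show ?thesis using 1 2 3 by linarith
    qed
    then have "B\<^sup>2 / 4 \<in> S" by (simp add: S_def)
    then show ?thesis by blast
  qed
  define \<mu> where "\<mu> = Inf S"
  have bdd: "bdd_below S" by (rule bdd_belowI[of _ 0]) (simp add: S_def)
  have \<mu>0: "\<mu> \<ge> 0" unfolding \<mu>_def by (rule cInf_greatest[OF \<open>S \<noteq> {}\<close>]) (simp add: S_def)
  \<comment> \<open>For each triple the condition on the number is a closed one, so the infimum satisfies it.\<close>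
  have \<mu>T: "ip l b u + \<mu> * ip l w u \<ge> 0" if t: "T u b w" for u b w
  proof (cases "ip l w u = 0")
    case True
    then show ?thesis using \<open>S \<noteq> {}\<close> t unfolding S_def by fastforce
  next
    case False
    then have pos: "ip l w u > 0" using Tw[OF t] by simp
    have "- ip l b u / ip l w u \<le> \<mu>" unfolding \<mu>_def
    proof (rule cInf_greatest[OF \<open>S \<noteq> {}\<close>])
      fix s assume "s \<in> S"
      then have "ip l b u + s * ip l w u \<ge> 0" using t by (simp add: S_def)
      then show "- ip l b u / ip l w u \<le> s" unfolding pos_divide_le_eq[OF pos] by linarith
    qed
    then show ?thesis unfolding pos_divide_le_eq[OF pos] by linarith
  qed
  have \<mu>pos: "\<mu> > 0"
  proof -
    obtain w0 where "(w0, u0) \<in> dirichlet_op l h" using surj[OF dirichlet_op_L2(1)[OF neg(1)]] by blast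
    then have "T u0 b0 w0" using neg(1) by (simp add: T_def)
    from \<mu>T[OF this] have "\<mu> \<noteq> 0" using neg(2) by auto
    then show ?thesis using \<mu>0 by simp
  qed
  define lam where "lam = sqrt \<mu>"
  have lam: "lam > 0" "lam\<^sup>2 = \<mu>" using \<mu>pos by (auto simp: lam_def)
  have "complex_of_real lam \<in> spectrum l pair_scale (block_op l g h)"
  proof (rule ccontr)
    assume "\<not> ?thesis"
    from block_op_resolvent[OF l lam(1) this] obtain C where C: "C > 0"
      "\<And>u. u \<in> L2 l \<Longrightarrow> \<exists>p c y. (p, c) \<in> dirichlet_op l g \<and> (y, p) \<in> dirichlet_op l h \<and>
       (\<forall>x. c x + \<mu> *\<^sub>R y x = u x) \<and> L2_norm l p \<le> C * L2_norm l u"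
      unfolding lam(2) by blast
    \<comment> \<open>With \<open>p\<close> the preimage of \<open>u\<close> under $L_+ + \mu A$, the form pairs \<open>u\<close> and \<open>p\<close> to $\|u\|^2$, and its
      value at \<open>p\<close> is $\langle p, u\rangle \le C \|u\|^2$. The Cauchy--Schwarz inequality for the form
      concludes.\<close>
    have coercive: "ip l u u \<le> C * (ip l b u + \<mu> * ip l w u)" if t: "T u b w" for u b w
    proof -
      note U = TL[OF t]
      obtain p c y where pcy: "(p, c) \<in> dirichlet_op l g" "(y, p) \<in> dirichlet_op l h"
        "\<And>x. c x + \<mu> *\<^sub>R y x = u x" "L2_norm l p \<le> C * L2_norm l u"
        using C(2)[OF U(1)] by blast
      then have t': "T p c y" by (simp add: T_def)
      note P = TL[OF t']
      have ub: "(u, b) \<in> dirichlet_op l g" "(w, u) \<in> dirichlet_op l h" using t by (simp_all add: T_def)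
      have u_eq: "u = (\<lambda>x. c x + \<mu> *\<^sub>R y x)" using pcy(3) by auto
      have iu: "ip l z u = ip l z c + \<mu> * ip l z y" if "z \<in> L2 l" for z
        using ip_linear(3)[OF P(2) L2_scaleR[OF P(3)] that, of \<mu>] u_eq by simp
      have s1: "ip l b p = ip l u c" by (rule dirichlet_symmetric[OF ub(1) pcy(1) g l])
      have s2: "ip l w p = ip l u y" using dirichlet_symmetric[OF ub(2) pcy(2) h l] by simp
      have cross: "ip l b p + \<mu> * ip l w p = ip l u u" unfolding s1 s2 using iu[OF U(1)] by simp
      have Qp: "ip l c p + \<mu> * ip l y p = ip l p u"
        using iu[OF P(1)] by (simp add: ip_commute[of l p])
      have "(ip l u u)\<^sup>2 \<le> (ip l b u + \<mu> * ip l w u) * (ip l c p + \<mu> * ip l y p)"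
      proof (rule discriminant_nonneg_quadratic)
        fix s :: real
        have "T (\<lambda>x. u x + s *\<^sub>R p x) (\<lambda>x. b x + s *\<^sub>R c x) (\<lambda>x. w x + s *\<^sub>R y x)"
          unfolding T_def using dirichlet_lincomb[OF ub(1) pcy(1) l] dirichlet_lincomb[OF ub(2) pcy(2) l] by simp
        from \<mu>T[OF this] have "0 \<le> ip l (\<lambda>x. b x + s *\<^sub>R c x) (\<lambda>x. u x + s *\<^sub>R p x)
            + \<mu> * ip l (\<lambda>x. w x + s *\<^sub>R y x) (\<lambda>x. u x + s *\<^sub>R p x)" .
        also have "\<dots> = (ip l b u + \<mu> * ip l w u) + s * (ip l b p + \<mu> * ip l w p)
            + s * (ip l u c + \<mu> * ip l u y) + s\<^sup>2 * (ip l c p + \<mu> * ip l y p)"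
          using U P by (simp add: ip_linear L2_add L2_scaleR ip_commute[of l _ u] power2_eq_square algebra_simps)
        also have "\<dots> = (ip l b u + \<mu> * ip l w u) + 2 * s * ip l u u + s\<^sup>2 * (ip l c p + \<mu> * ip l y p)"
          using cross iu[OF U(1)] by simp
        finally show "0 \<le> \<dots>" .
      qed (rule \<mu>T[OF t'])
      also have "\<dots> \<le> (ip l b u + \<mu> * ip l w u) * (C * ip l u u)"
      proof (rule mult_left_mono[OF _ \<mu>T[OF t]])
        have "ip l p u \<le> L2_norm l p * L2_norm l u" using ip_Cauchy_Schwarz[OF P(1) U(1)] by linarith
        also have "\<dots> \<le> C * L2_norm l u * L2_norm l u" by (rule mult_right_mono[OF pcy(4) L2_norm_nonneg])
        finally show "ip l c p + \<mu> * ip l y p \<le> C * ip l u u"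
          unfolding Qp by (simp add: L2_norm_sq[symmetric] power2_eq_square)
      qed
      finally have *: "ip l u u * ip l u u \<le> C * (ip l b u + \<mu> * ip l w u) * ip l u u"
        by (simp add: power2_eq_square mult_ac)
      show ?thesis
      proof (cases "ip l u u = 0")
        case True
        then show ?thesis using C(1) \<mu>T[OF t] by simp
      next
        case False
        then have "ip l u u > 0" using ip_nonneg[of l u] by simp
        then show ?thesis using mult_right_le_imp_le[OF *] by blast
      qed
    qed
    \<comment> \<open>Lowering $\mu$ by $\epsilon$ costs at most $\epsilon C_1 \|u\|^2$, which coercivity absorbs if
      $\epsilon C C_1 \le 1$.\<close>
    define \<epsilon> where "\<epsilon> = min \<mu> (1 / (C * C1))"
    have \<epsilon>: "\<epsilon> > 0" "\<epsilon> \<le> \<mu>" "C * (\<epsilon> * C1) \<le> 1"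
    proof -
      show "\<epsilon> > 0" "\<epsilon> \<le> \<mu>" using \<mu>pos C(1) C1 by (auto simp: \<epsilon>_def)
      have "\<epsilon> \<le> 1 / (C * C1)" by (simp add: \<epsilon>_def)
      then show "C * (\<epsilon> * C1) \<le> 1" using C(1) C1 by (simp add: pos_le_divide_eq mult_ac)
    qed
    have "ip l b u + (\<mu> - \<epsilon>) * ip l w u \<ge> 0" if t: "T u b w" for u b w
    proof -
      have "C * (\<epsilon> * ip l w u) \<le> C * (\<epsilon> * (C1 * ip l u u))"
        using wbound[OF t] C(1) \<epsilon>(1) by (intro mult_left_mono) auto
      also have "\<dots> = C * (\<epsilon> * C1) * ip l u u" by simp
      also have "\<dots> \<le> 1 * ip l u u" by (rule mult_right_mono[OF \<epsilon>(3) ip_nonneg])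
      also have "\<dots> \<le> C * (ip l b u + \<mu> * ip l w u)" using coercive[OF t] by simp
      finally have "\<epsilon> * ip l w u \<le> ip l b u + \<mu> * ip l w u" using C(1) by simp
      then show ?thesis by (simp add: algebra_simps)
    qed
    then have "\<mu> - \<epsilon> \<in> S" using \<epsilon>(2) by (simp add: S_def)
    then have "\<mu> \<le> \<mu> - \<epsilon>" unfolding \<mu>_def by (rule cInf_lower[OF _ bdd])
    then show False using \<epsilon>(1) by simp
  qed
  then show ?thesis using lam(1) by (intro that)
qed

section \<open>The linearization about the standing wave\<close>

lemma C_k_on_Suc_has_vector_derivative:
  assumes "C_k_on (Suc k) f S" "x \<in> S"
  shows "(f has_vector_derivative deriv_on S f x) (at x within S)"
  using assms by (simp add: deriv_on_def vector_derivative_works)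

lemma C_k_on_Suc_deriv_on: "C_k_on (Suc k) f S \<Longrightarrow> C_k_on k (deriv_on S f) S"
  by simp

lemma C_k_on_imp_continuous_on: "C_k_on k f S \<Longrightarrow> continuous_on S f"
proof (cases k)
  case (Suc j)
  assume "C_k_on k f S"
  then show ?thesis
    using Suc by (auto simp: continuous_on_eq_continuous_within intro: differentiable_imp_continuous_within)
qed simp

lemma N_op_block: "N_op f \<beta> l \<phi> = block_op l (g_pot f \<beta> \<phi>) (h_pot f \<beta> \<phi>)"
  unfolding N_op_def block_op_def L_plus_def L_minus_def ..

lemma spectrum_zero: "0 \<notin> spectrum l (*) A \<longleftrightarrow> boundedly_invertible l A"
proof -
  have "{(u, \<lambda>x. v x - 0 * u x) | u v. (u, v) \<in> A} = A" for A :: "((real \<Rightarrow> complex) \<times> (real \<Rightarrow> complex)) set"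
    by auto
  then show ?thesis by (simp add: spectrum_def)
qed

text \<open>
  A nontrivial solution of \<open>a'' = - g a\<close> with Dirichlet boundary values lies in the kernel of the
  operator, so that solutions of the inhomogeneous equation are not unique.
\<close>

lemma zero_in_spectrum_dirichlet:
  fixes a b g :: "real \<Rightarrow> real"
  assumes l: "l > 0"
    and d1: "\<And>x. x \<in> {0..l} \<Longrightarrow> (a has_vector_derivative b x) (at x within {0..l})"
    and d2: "\<And>x. x \<in> {0..l} \<Longrightarrow> (b has_vector_derivative - (g x * a x)) (at x within {0..l})"
    and g: "continuous_on {0..l} g" and bc: "a 0 = 0" "a l = 0" and y: "y \<in> {0..l}" "a y \<noteq> 0"
  shows "\<not> boundedly_invertible l (dirichlet_op l g)"
proof
  assume "boundedly_invertible l (dirichlet_op l g)"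
  then have uniq: "AE x in meas l. u x = u' x"
    if "(u, w) \<in> dirichlet_op l g" "(u', w) \<in> dirichlet_op l g" for u u' w
    using that unfolding boundedly_invertible_def by blast
  have ca: "continuous_on {0..l} a"
    using d1 by (meson continuous_on_eq_continuous_within has_vector_derivative_continuous)
  have "continuous_on {0..l} (\<lambda>x. - (g x * a x))" by (intro continuous_intros g ca)
  from dirichlet_classical[OF l d1 d2 this g bc]
  have "(\<lambda>x. complex_of_real (a x), \<lambda>x. 0) \<in> dirichlet_op l g" by simp
  moreover have "(\<lambda>x. 0, \<lambda>x. 0) \<in> dirichlet_op l g"
    using dirichlet_classical[OF l, of "\<lambda>_. 0" "\<lambda>_. 0" "\<lambda>_. 0" g] g by simp
  ultimately have ae: "AE x in meas l. complex_of_real (a x) = 0" by (rule uniq)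
  have ca2: "continuous_on {0..l} (\<lambda>x. (a x)\<^sup>2)" by (intro continuous_intros ca)
  have "(\<integral>x. (a x)\<^sup>2 \<partial>(meas l)) = 0"
    by (rule integral_eq_zero_AE) (use ae in simp)
  then have "((\<lambda>x. (a x)\<^sup>2) has_integral 0) {0<..<l}"
    using has_integral_integral_lebesgue_on[OF continuous_on_integrable_meas[OF ca2]] by simp
  then have "((\<lambda>x. (a x)\<^sup>2) has_integral 0) (cbox 0 l)"
    by (simp add: has_integral_Icc_iff_Ioo)
  from has_integral_0_cbox_imp_0[OF _ _ this, of y] have "(a y)\<^sup>2 = 0"
    using ca2 l y by simp
  then show False using y(2) by simp
qed

theorem corollary2p8:
  fixes f \<phi> :: "real \<Rightarrow> real" and \<beta> l :: real
  assumes "C_k_on 3 f {0..}"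
    and "l > 0"
    and "neumann_profile f \<beta> l \<phi>"
    and "0 \<notin> spectrum l (*) (L_minus f \<beta> l \<phi>) \<inter> spectrum l (*) (L_plus f \<beta> l \<phi>)"
    and "\<not> \<phi> constant_on {0..l}"
    and "\<forall>x\<in>{0..l}. \<phi> x \<noteq> 0"
    and "\<exists>x\<in>{0<..<l}. deriv_on {0..l} \<phi> x = 0"
  shows "spectrally_unstable f \<beta> l \<phi>"
proof -
  (* The derivative a of the profile solves a'' = - g a, and a'' is found by differentiating the
     profile equation; the profile itself solves phi'' = - h phi. *)
  define a where "a = deriv_on {0..l} \<phi>"
  define b where "b = deriv_on {0..l} a"
  define f' where "f' = deriv_on {0..} f"
  define g where "g = g_pot f \<beta> \<phi>"
  define h where "h = h_pot f \<beta> \<phi>"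
  note l = assms(2)
  have f3: "C_k_on (Suc (Suc (Suc 0))) f {0..}" using assms(1) by (simp only: numeral_3_eq_3)
  have df: "(f has_vector_derivative f' y) (at y within {0..})" if "y \<ge> 0" for y
    using C_k_on_Suc_has_vector_derivative[OF f3] that by (simp add: f'_def)
  have "C_k_on (Suc (Suc 0)) f' {0..}" unfolding f'_def by (rule C_k_on_Suc_deriv_on[OF f3])
  then have cf': "continuous_on {0..} f'" by (rule C_k_on_imp_continuous_on)
  have cf: "continuous_on {0..} f" by (rule C_k_on_imp_continuous_on[OF f3])
  note profile = assms(3)[unfolded neumann_profile_def, folded a_def, folded b_def]
  then have "C_k_on 2 \<phi> {0..l}" by (rule conjunct1)
  then have C2: "C_k_on (Suc (Suc 0)) \<phi> {0..l}" by (simp only: numeral_2_eq_2)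
  have bc: "a 0 = 0" "a l = 0" using profile by blast+
  have ode: "\<forall>x\<in>{0..l}. b x + f ((\<phi> x)\<^sup>2) * \<phi> x + \<beta> * \<phi> x = 0"
    using profile by blast
  have beq: "b x = - (f ((\<phi> x)\<^sup>2) * \<phi> x + \<beta> * \<phi> x)" if "x \<in> {0..l}" for x
    using bspec[OF ode that] by linarith
  have C1: "C_k_on (Suc 0) a {0..l}" unfolding a_def by (rule C_k_on_Suc_deriv_on[OF C2])
  have d\<phi>: "(\<phi> has_vector_derivative a x) (at x within {0..l})" if "x \<in> {0..l}" for x
    using C_k_on_Suc_has_vector_derivative[OF C2 that] by (simp add: a_def)
  have da: "(a has_vector_derivative b x) (at x within {0..l})" if "x \<in> {0..l}" for x
    using C_k_on_Suc_has_vector_derivative[OF C1 that] by (simp add: b_def)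
  have c\<phi>: "continuous_on {0..l} \<phi>" by (rule C_k_on_imp_continuous_on[OF C2])
  have c\<phi>2: "continuous_on {0..l} (\<lambda>x. f ((\<phi> x)\<^sup>2))" "continuous_on {0..l} (\<lambda>x. f' ((\<phi> x)\<^sup>2))"
    by (rule continuous_on_compose2[OF cf] continuous_on_compose2[OF cf'];
        auto intro!: continuous_intros c\<phi>)+
  have g: "continuous_on {0..l} g" unfolding g_def g_pot_def[abs_def] f'_def[symmetric]
    by (intro continuous_intros c\<phi> c\<phi>2)
  have h: "continuous_on {0..l} h" unfolding h_def h_pot_def[abs_def] by (intro continuous_intros c\<phi>2)
  have da': "(a has_vector_derivative - (h x * \<phi> x)) (at x within {0..l})" if "x \<in> {0..l}" for x
    using da[OF that] unfolding beq[OF that] h_def h_pot_def by (simp add: algebra_simps)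
  have db: "(b has_vector_derivative - (g x * a x)) (at x within {0..l})" if x: "x \<in> {0..l}" for x
  proof -
    have e\<phi>: "(\<phi> has_real_derivative a x) (at x within {0..l})"
      using d\<phi>[OF x] by (simp add: has_real_derivative_iff_has_vector_derivative)
    have sq: "((\<lambda>x. (\<phi> x)\<^sup>2) has_real_derivative 2 * (\<phi> x * a x)) (at x within {0..l})"
      using DERIV_mult[OF e\<phi> e\<phi>] by (simp add: power2_eq_square)
    have "(f has_real_derivative f' ((\<phi> x)\<^sup>2)) (at ((\<phi> x)\<^sup>2) within (\<lambda>x. (\<phi> x)\<^sup>2) ` {0..l})"
      by (rule has_field_derivative_subset[of _ _ _ "{0..}"])
         (use df[of "(\<phi> x)\<^sup>2"] in \<open>auto simp: has_real_derivative_iff_has_vector_derivative\<close>)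
    from DERIV_image_chain[OF this sq]
    have fc: "((\<lambda>x. f ((\<phi> x)\<^sup>2)) has_real_derivative f' ((\<phi> x)\<^sup>2) * (2 * (\<phi> x * a x))) (at x within {0..l})"
      by (simp add: o_def)
    have "((\<lambda>x. - (f ((\<phi> x)\<^sup>2) * \<phi> x + \<beta> * \<phi> x)) has_real_derivative
        - (f' ((\<phi> x)\<^sup>2) * (2 * (\<phi> x * a x)) * \<phi> x + a x * f ((\<phi> x)\<^sup>2) + \<beta> * a x)) (at x within {0..l})"
      by (rule DERIV_minus[OF DERIV_add[OF DERIV_mult[OF fc e\<phi>] DERIV_cmult[OF e\<phi>]]])
    moreover have "- (f' ((\<phi> x)\<^sup>2) * (2 * (\<phi> x * a x)) * \<phi> x + a x * f ((\<phi> x)\<^sup>2) + \<beta> * a x) = - (g x * a x)"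
      by (simp add: g_def g_pot_def f'_def power2_eq_square algebra_simps)
    ultimately have "((\<lambda>x. - (f ((\<phi> x)\<^sup>2) * \<phi> x + \<beta> * \<phi> x)) has_vector_derivative - (g x * a x)) (at x within {0..l})"
      by (simp only: has_real_derivative_iff_has_vector_derivative)
    then show ?thesis by (rule has_vector_derivative_transform[OF x, rotated]) (simp add: beq)
  qed
  obtain y where y: "y \<in> {0..l}" "a y \<noteq> 0"
  proof -
    have "\<phi> constant_on {0..l}" if "\<And>x. x \<in> {0..l} \<Longrightarrow> a x = 0"
    proof -
      have "(\<phi> has_vector_derivative 0) (at x within {0..l})" if "x \<in> {0..l}" for x
        using d\<phi>[OF that] \<open>\<And>x. x \<in> {0..l} \<Longrightarrow> a x = 0\<close>[OF that] by simp
      then obtain c where "\<And>x. x \<in> {0..l} \<Longrightarrow> \<phi> x = c"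
        using has_vector_derivative_zero_constant[of "{0..l}" \<phi>] by auto
      then show ?thesis unfolding constant_on_def by blast
    qed
    then show ?thesis using assms(5) that by blast
  qed
  \<comment> \<open>The spectral hypothesis thereby becomes invertibility of $L_-$.\<close>
  have "0 \<in> spectrum l (*) (L_plus f \<beta> l \<phi>)"
    using zero_in_spectrum_dirichlet[OF l da db g bc y] spectrum_zero[of l "L_plus f \<beta> l \<phi>"]
    unfolding L_plus_def g_def by blast
  then have inv: "boundedly_invertible l (dirichlet_op l h)"
    using assms(4) spectrum_zero[of l "L_minus f \<beta> l \<phi>"] unfolding L_minus_def h_def by blast
  have nonneg: "ip l v w \<ge> 0" if "(w, v) \<in> dirichlet_op l h" for w v
    by (rule dirichlet_op_nonneg[OF l that d\<phi> da' bspec[OF assms(6)] h])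
  obtain m where m: "m \<in> {0<..<l}" "a m = 0" using assms(7) unfolding a_def by blast
  \<comment> \<open>Otherwise \<open>a\<close> would vanish with its derivative at \<open>m\<close>, hence identically.\<close>
  have "b m \<noteq> 0"
    using second_order_ode_unique_zero[OF da db g _ m(2) _ y(1)] m(1) y(2) by auto
  then obtain u v where "(u, v) \<in> dirichlet_op l g" "ip l v u < 0"
    using dirichlet_negative_direction[OF da db g bc(1) m] by blast
  then obtain lam :: real where "lam > 0" "complex_of_real lam \<in> spectrum l pair_scale (block_op l g h)"
    using positive_spectrum_of_block_operator[OF l g h nonneg inv] by blast
  then show ?thesis
    unfolding spectrally_unstable_def N_op_block g_def h_def by (intro bexI[of _ "complex_of_real lam"]) simp_all
qed

end
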